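(* Suppose $L$ is a countable cyclically transitive linear order. Then $L$ is cyclically equivalent to a linear order $L'$ whose order type is either $\zeta^\alpha\cdot\mathbf{n}$ or $\zeta^\alpha\cdot\eta$ for some countable ordinal $\alpha$ and some finite $n$.
   Context: Linear orders may be empty, and countable includes finite. $L_1+L_2$ denotes the ordered sum (every element of $L_1$ strictly below every element of $L_2$); a partition $L=L_1+L_2$ means that $L_1$ is an initial segment of $L$ and $L_2$ is its complement (either may be empty). The product $L_1\cdot L_2$ is $L_1\times L_2$ with the colexicographic order (the second coordinate takes precedence over the first). $L$ is cyclically transitive if for any $a\le b$ in $L$ there exist partitions $L=L_1+L_2=L_2'+L_1'$ with $a\in L_1$, $b\in L_1'$, and order isomorphisms $F_1:L_1\to L_1'$, $F_2:L_2\to L_2'$ satisfying $F_1(a)=b$. Linear orders $L,L'$ are cyclically equivalent if there are partitions $L=L_1+L_2$ and $L'=L_2'+L_1'$ with order isomorphisms $L_1\to L_1'$ and $L_2\to L_2'$. $\mathbf n$ is the linear order with $n$ elements ($n\in\mathbb N$, with $0\in\mathbb N$), and $\zeta$, $\eta$ are the order types of $\mathbb Z$ and $\mathbb Q$. For an ordinal $\alpha$, $\zeta^\alpha$ is the order type of the set of functions $f:\alpha\to\mathbb Z$ that are $0$ at all but finitely many places, ordered for distinct $f,g$ by $f<g$ iff $f(\beta)<g(\beta)$ at the greatest $\beta\in\alpha$ with $f(\beta)\neq g(\beta)$ (replacing $0$ by any other base point gives the same order type). *)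

theory Defs
  imports Complex_Main "HOL-Library.Countable_Set"
begin

text \<open>
  A linear order is a reflexive relation \<open>r\<close> with \<open>Linear_order r\<close>; its set of points is
  \<open>Field r\<close>, which may be empty. Order isomorphisms are the library's \<open>iso\<close>;
  for this to be the usual notion, see \<open>iso_iff2\<close>.
\<close>

definition is_partition :: "'a rel \<Rightarrow> 'a set \<Rightarrow> 'a set \<Rightarrow> bool" where
  "is_partition r A B \<longleftrightarrow> ofilter r A \<and> B = Field r - A"

text \<open>\<open>A + B\<close> is the first partition and \<open>B' + A'\<close> the second one.\<close>

definition cyclically_transitive :: "'a rel \<Rightarrow> bool" where
  "cyclically_transitive r \<longleftrightarrow>
     (\<forall>a b. (a, b) \<in> r \<longrightarrow>
        (\<exists>A B A' B' F G.
           is_partition r A B \<and> is_partition r B' A' \<and> a \<in> A \<and> b \<in> A' \<and>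
           iso (Restr r A) (Restr r A') F \<and> iso (Restr r B) (Restr r B') G \<and> F a = b))"

definition cyclically_equivalent :: "'a rel \<Rightarrow> 'b rel \<Rightarrow> bool" where
  "cyclically_equivalent r s \<longleftrightarrow>
     (\<exists>A B A' B' F G.
        is_partition r A B \<and> is_partition s B' A' \<and>
        iso (Restr r A) (Restr s A') F \<and> iso (Restr r B) (Restr s B') G)"

definition same_order_type :: "'a rel \<Rightarrow> 'b rel \<Rightarrow> bool" where
  "same_order_type r s \<longleftrightarrow> (\<exists>f. iso r s f)"

definition colex_prod :: "'a rel \<Rightarrow> 'b rel \<Rightarrow> ('a \<times> 'b) rel" where
  "colex_prod r s =
     {((a, b), (a', b')). a \<in> Field r \<and> a' \<in> Field r \<and> b \<in> Field s \<and> b' \<in> Field s \<and>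
        (b \<noteq> b' \<and> (b, b') \<in> s \<or> b = b' \<and> (a, a') \<in> r)}"

definition eta_order :: "rat rel" where
  "eta_order = {(p, q). p \<le> q}"

text \<open>
  The ordinal is given by a well-order \<open>w\<close>; a function from it to the integers is encoded as a
  total function that is 0 outside \<open>Field w\<close>.
\<close>

definition fin_supp_funs :: "'b rel \<Rightarrow> ('b \<Rightarrow> int) set" where
  "fin_supp_funs w = {f. finite {x. f x \<noteq> 0} \<and> {x. f x \<noteq> 0} \<subseteq> Field w}"

definition zeta_power :: "'b rel \<Rightarrow> ('b \<Rightarrow> int) rel" where
  "zeta_power w =
     {(f, g). f \<in> fin_supp_funs w \<and> g \<in> fin_supp_funs w \<and>
        (f = g \<or>
         (\<exists>x \<in> Field w. f x \<noteq> g x \<and> (\<forall>y \<in> Field w. f y \<noteq> g y \<longrightarrow> (y, x) \<in> w) \<and> f x < g x))}"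

end

theory Submission
  imports Defs
begin

text \<open>
  Embed \<open>L\<close> into \<open>[0, 1)\<close> and take its orbit under integer translations. Cyclic automorphisms of \<open>L\<close>
  lift to automorphisms of this periodic chain \<open>X\<close> that commute with \<open>x \<mapsto> x + 1\<close>, and these act
  transitively. For a transitive action the convex invariant equivalences (congruences) form a
  chain. For a congruence \<open>E\<close>, let \<open>steps E\<close> relate points with finitely many \<open>E\<close>-classes between
  them; if \<open>steps E \<noteq> E\<close>, the \<open>E\<close>-classes in a \<open>steps E\<close>-class have order type \<open>\<zeta>\<close>.
  Let \<open>N\<close> be maximal among the congruences that separate \<open>p\<close> from \<open>p + 1\<close> and below which \<open>steps\<close>
  is never stationary. The congruences strictly below \<open>N\<close> are well-ordered by inclusion, and recording for
  each of them the position of \<open>x\<close> relative to a canonical representative gives an isomorphism of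
  every \<open>N\<close>-class with \<open>\<zeta>\<^sup>\<alpha>\<close>. By maximality either \<open>steps N = N\<close>, so that \<open>X / N\<close> is dense, or there are
  finitely many \<open>N\<close>-classes between \<open>p\<close> and \<open>p + 1\<close>. In either case a fundamental domain for the
  translation, cut along \<open>N\<close>-classes (in the dense case at a gap), is the required \<open>L'\<close>.
\<close>

subsection \<open>Countable dense orders\<close>

text \<open>A cyclic map of \<open>L\<close> does not preserve the order of \<open>L\<close>: it
  moves an initial segment to the end. Unrolled into Z consecutive copies of \<open>L\<close>, such
  maps become genuine order automorphisms, to which the theory of convex congruences applies; that
  they commute with the unit translation is what lets the result descend again. Separating
  \<open>p\<close> from \<open>p + 1\<close> is, by transitivity, the same condition at every point;
  it keeps each \<open>N\<close>-class shorter than a period, so that a fundamental domain can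
  consist of whole classes.

  The obstacle in the coordinates is the choice of origins: each level needs one in every copy of Z,
  and uncoordinated choices would give points with infinitely many nonzero coordinates. One fixed
  enumeration of \<open>X\<close> serves all levels at once: the origin is the class of the point of
  least index. No recursion along \<alpha> is needed; \<alpha> is the order type of the congruences
  strictly below \<open>N\<close>.

  In the dense case a cut beside a class would leave the domain with a first or a last class, hence
  with 1 + eta or eta + 1 in place of eta. This is why a gap is needed there.\<close>

definition dense_unbounded :: "'a::linorder set \<Rightarrow> bool" where
  "dense_unbounded A \<longleftrightarrow> A \<noteq> {} \<and>
     (\<forall>x\<in>A. \<exists>y\<in>A. y < x) \<and> (\<forall>x\<in>A. \<exists>y\<in>A. x < y) \<and>
     (\<forall>x\<in>A. \<forall>y\<in>A. x < y \<longrightarrow> (\<exists>z\<in>A. x < z \<and> z < y))"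

definition partial_iso :: "('a::linorder \<times> 'b::linorder) set \<Rightarrow> bool" where
  "partial_iso P \<longleftrightarrow> (\<forall>(a, b)\<in>P. \<forall>(a', b')\<in>P. a < a' \<longleftrightarrow> b < b')"

lemma partial_iso_eq_iff:
  assumes "partial_iso P" "(a, b) \<in> P" "(a', b') \<in> P"
  shows "a = a' \<longleftrightarrow> b = b'"
proof -
  have "a < a' \<longleftrightarrow> b < b'" "a' < a \<longleftrightarrow> b' < b"
    using assms unfolding partial_iso_def by fast+
  then show ?thesis by (metis neq_iff)
qed

lemma partial_iso_converse: "partial_iso (P\<inverse>) \<longleftrightarrow> partial_iso P"
  unfolding partial_iso_def by fast

text \<open>Either set may be empty. Density handles two nonempty sets, through \<open>Max S\<close>
  and \<open>Min T\<close>; unboundedness handles one, nonemptiness of \<open>B\<close>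
  none.\<close>

lemma dense_unbounded_between:
  assumes B: "dense_unbounded B" and fin: "finite S" "finite T" and sub: "S \<subseteq> B" "T \<subseteq> B"
    and less: "\<And>s t. s \<in> S \<Longrightarrow> t \<in> T \<Longrightarrow> s < t"
  obtains b where "b \<in> B" "\<And>s. s \<in> S \<Longrightarrow> s < b" "\<And>t. t \<in> T \<Longrightarrow> b < t"
proof -
  have "\<exists>b\<in>B. (\<forall>s\<in>S. s < b) \<and> (\<forall>t\<in>T. b < t)"
  proof (cases "S = {}")
    case S: True
    show ?thesis
    proof (cases "T = {}")
      case True
      then show ?thesis using S B unfolding dense_unbounded_def by auto
    next
      case False
      then have "Min T \<in> B" using fin sub Min_in by blast
      then obtain b where "b \<in> B" "b < Min T" using B unfolding dense_unbounded_def by blast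
      then show ?thesis using S False fin by auto
    qed
  next
    case S: False
    then have maxS: "Max S \<in> S" "Max S \<in> B" using fin sub Max_in by blast+
    show ?thesis
    proof (cases "T = {}")
      case True
      from maxS obtain b where "b \<in> B" "Max S < b" using B unfolding dense_unbounded_def by blast
      then show ?thesis using S True fin by auto
    next
      case False
      then have minT: "Min T \<in> T" "Min T \<in> B" using fin sub Min_in by blast+
      then obtain b where "b \<in> B" "Max S < b" "b < Min T"
        using B maxS less unfolding dense_unbounded_def by blast
      then show ?thesis using S False fin by auto
    qed
  qed
  then show thesis using that by blast
qed

text \<open>The forth step: the partners of the points to the left of \<open>a\<close> all lie below
  the partners of those to its right, so a partner for \<open>a\<close> fits between.\<close>

lemma partial_iso_extend:
  assumes P: "finite P" "partial_iso P" "P \<subseteq> A \<times> B" and B: "dense_unbounded B" and a: "a \<in> A"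
  obtains b where "b \<in> B" "partial_iso (insert (a, b) P)"
proof (cases "a \<in> fst ` P")
  case True
  then obtain b where b: "(a, b) \<in> P" by force
  then have "insert (a, b) P = P" by blast
  then show thesis using that[of b] P b by auto
next
  case False
  define S where "S = snd ` {q \<in> P. fst q < a}"
  define T where "T = snd ` {q \<in> P. a < fst q}"
  have "finite S" "finite T" "S \<subseteq> B" "T \<subseteq> B" unfolding S_def T_def using P by auto
  moreover have "s < t" if "s \<in> S" "t \<in> T" for s t
    using that P(2) unfolding S_def T_def partial_iso_def by fastforce
  ultimately obtain b where b: "b \<in> B" "\<And>s. s \<in> S \<Longrightarrow> s < b" "\<And>t. t \<in> T \<Longrightarrow> b < t"
    using dense_unbounded_between[OF B] by metis
  have cmp: "(a < x \<longleftrightarrow> b < y) \<and> (x < a \<longleftrightarrow> y < b)" if "(x, y) \<in> P" for x y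
  proof -
    have "x \<noteq> a" using False that by force
    then consider "x < a" | "a < x" by (meson neq_iff)
    then show ?thesis
    proof cases
      case 1
      then have "y \<in> S" unfolding S_def using that by force
      then show ?thesis using 1 b(2) by (meson less_asym)
    next
      case 2
      then have "y \<in> T" unfolding T_def using that by force
      then show ?thesis using 2 b(3) by (meson less_asym)
    qed
  qed
  have "partial_iso (insert (a, b) P)"
    using P(2) cmp unfolding partial_iso_def by fastforce
  then show thesis using that b(1) by blast
qed

lemma partial_iso_extend_both:
  assumes P: "finite P" "partial_iso P" "P \<subseteq> A \<times> B"
    and AB: "dense_unbounded A" "dense_unbounded B" and a: "a \<in> A" and b: "b \<in> B"
  obtains Q where "finite Q" "partial_iso Q" "Q \<subseteq> A \<times> B" "P \<subseteq> Q" "a \<in> fst ` Q" "b \<in> snd ` Q"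
proof -
  obtain b' where b': "b' \<in> B" "partial_iso (insert (a, b') P)"
    using partial_iso_extend[OF P AB(2) a] by metis
  define P' where "P' = insert (a, b') P"
  have P': "finite (P'\<inverse>)" "partial_iso (P'\<inverse>)" "P'\<inverse> \<subseteq> B \<times> A"
    using P a b' by (auto simp: P'_def partial_iso_converse)
  \<comment> \<open>The back step is the forth step for the converse relation, with \<open>A\<close>
    and \<open>B\<close> exchanged.\<close>
  obtain a' where a': "a' \<in> A" "partial_iso (insert (b, a') (P'\<inverse>))"
    using partial_iso_extend[OF P' AB(1) b] by metis
  have "insert (b, a') (P'\<inverse>) = (insert (a', b) P')\<inverse>" by auto
  then have "partial_iso (insert (a', b) P')" using a' by (metis partial_iso_converse)
  then show thesis
    by (intro that[of "insert (a', b) P'"]) (use P a' b' a b in \<open>auto simp: P'_def\<close>)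
qed

text \<open>Cantor's back-and-forth argument. It is stated for subsets of linear orders because it
  is applied to sets of class representatives and to the rationals without 0.\<close>

theorem countable_dense_unbounded_iso:
  fixes A :: "'a::linorder set" and B :: "'b::linorder set"
  assumes cnt: "countable A" "countable B" and AB: "dense_unbounded A" "dense_unbounded B"
  obtains h where "bij_betw h A B" "strict_mono_on A h"
proof -
  have ne: "A \<noteq> {}" "B \<noteq> {}" using AB by (auto simp: dense_unbounded_def)
  define good where "good P \<longleftrightarrow> finite P \<and> partial_iso P \<and> P \<subseteq> A \<times> B" for P
  \<comment> \<open>Stage \<open>n\<close> takes care of the \<open>n\<close>-th point in a fixed
    enumeration of each side, so that the union is total and onto.\<close>
  have "\<exists>P. \<forall>n. good (P n) \<and> (P n \<subseteq> P (Suc n) \<and>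
      from_nat_into A n \<in> fst ` P (Suc n) \<and> from_nat_into B n \<in> snd ` P (Suc n))"
  proof (rule dependent_nat_choice)
    show "\<exists>P. good P" by (rule exI[of _ "{}"]) (simp add: good_def partial_iso_def)
  next
    fix P n assume "good P"
    then show "\<exists>Q. good Q \<and> P \<subseteq> Q \<and> from_nat_into A n \<in> fst ` Q \<and> from_nat_into B n \<in> snd ` Q"
      using partial_iso_extend_both[OF _ _ _ AB from_nat_into[OF ne(1)] from_nat_into[OF ne(2)]]
      unfolding good_def by metis
  qed
  then obtain P where P: "\<And>n. good (P n)" "\<And>n. P n \<subseteq> P (Suc n)"
    "\<And>n. from_nat_into A n \<in> fst ` P (Suc n)" "\<And>n. from_nat_into B n \<in> snd ` P (Suc n)"
    by metis
  define U where "U = (\<Union>n. P n)"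
  have mono: "P m \<subseteq> P n" if "m \<le> n" for m n using lift_Suc_mono_le[of P, OF P(2) that] .
  have U: "partial_iso U"
    unfolding partial_iso_def
  proof (clarsimp)
    fix a b a' b' assume "(a, b) \<in> U" "(a', b') \<in> U"
    then obtain m n where "(a, b) \<in> P m" "(a', b') \<in> P n" by (auto simp: U_def)
    then have "(a, b) \<in> P (max m n)" "(a', b') \<in> P (max m n)"
      using mono[of m "max m n"] mono[of n "max m n"] by auto
    then show "a < a' \<longleftrightarrow> b < b'" using P(1)[of "max m n"] unfolding good_def partial_iso_def by fast
  qed
  have dom: "\<exists>b. (a, b) \<in> U" if a: "a \<in> A" for a
  proof -
    obtain n where "from_nat_into A n = a" using from_nat_into_surj[OF cnt(1) a] by blast
    then obtain q where "q \<in> P (Suc n)" "fst q = a" using P(3)[of n] by auto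
    then have "(a, snd q) \<in> U" unfolding U_def by auto
    then show ?thesis by blast
  qed
  have ran: "\<exists>a. (a, b) \<in> U" if b: "b \<in> B" for b
  proof -
    obtain n where "from_nat_into B n = b" using from_nat_into_surj[OF cnt(2) b] by blast
    then obtain q where "q \<in> P (Suc n)" "snd q = b" using P(4)[of n] by auto
    then have "(fst q, b) \<in> U" unfolding U_def by auto
    then show ?thesis by blast
  qed
  have sub: "U \<subseteq> A \<times> B" using P(1) unfolding U_def good_def by blast
  from dom obtain h where h: "\<And>a. a \<in> A \<Longrightarrow> (a, h a) \<in> U" by metis
  have inj: "inj_on h A"
    by (rule inj_onI) (metis h partial_iso_eq_iff[OF U])
  have "B \<subseteq> h ` A"
  proof
    fix b assume "b \<in> B"
    then obtain a where a: "(a, b) \<in> U" using ran by blast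
    then have "a \<in> A" using sub by blast
    moreover have "h a = b" using partial_iso_eq_iff[OF U h[OF \<open>a \<in> A\<close>] a] by simp
    ultimately show "b \<in> h ` A" by blast
  qed
  moreover have "h ` A \<subseteq> B" using h sub by blast
  ultimately have "bij_betw h A B" using inj by (simp add: bij_betw_def)
  moreover have "strict_mono_on A h"
    by (rule strict_mono_onI) (use U h in \<open>unfold partial_iso_def, fast\<close>)
  ultimately show thesis using that by blast
qed

subsection \<open>Congruences of a transitive chain\<close>

locale transitive_chain =
  fixes X :: "'a::linorder set" and G :: "('a \<Rightarrow> 'a) set"
  assumes countable_X: "countable X"
    and maps: "g \<in> G \<Longrightarrow> x \<in> X \<Longrightarrow> g x \<in> X"
    and mono: "g \<in> G \<Longrightarrow> x \<in> X \<Longrightarrow> y \<in> X \<Longrightarrow> x < y \<Longrightarrow> g x < g y"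
    and inverse: "g \<in> G \<Longrightarrow> \<exists>h\<in>G. \<forall>x\<in>X. h (g x) = x \<and> g (h x) = x"
    and transitive: "x \<in> X \<Longrightarrow> y \<in> X \<Longrightarrow> \<exists>g\<in>G. g x = y"
begin

text \<open>The convex congruences, or convex block systems, of an ordered permutation group. The
  other half of convexity, relating \<open>y\<close> to \<open>z\<close>, follows by symmetry and
  transitivity.\<close>

definition congruence :: "('a \<times> 'a) set \<Rightarrow> bool" where
  "congruence E \<longleftrightarrow> equiv X E \<and>
     (\<forall>x y z. (x, z) \<in> E \<longrightarrow> y \<in> X \<longrightarrow> x \<le> y \<longrightarrow> y \<le> z \<longrightarrow> (x, y) \<in> E) \<and>
     (\<forall>g\<in>G. \<forall>x y. (x, y) \<in> E \<longrightarrow> (g x, g y) \<in> E)"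

lemma congruenceD:
  assumes "congruence E"
  shows cong_sub: "(x, y) \<in> E \<Longrightarrow> x \<in> X \<and> y \<in> X"
    and cong_refl: "x \<in> X \<Longrightarrow> (x, x) \<in> E"
    and cong_sym: "(x, y) \<in> E \<Longrightarrow> (y, x) \<in> E"
    and cong_trans: "(x, y) \<in> E \<Longrightarrow> (y, z) \<in> E \<Longrightarrow> (x, z) \<in> E"
    and cong_convex: "(x, z) \<in> E \<Longrightarrow> y \<in> X \<Longrightarrow> x \<le> y \<Longrightarrow> y \<le> z \<Longrightarrow> (x, y) \<in> E"
    and cong_invariant: "g \<in> G \<Longrightarrow> (x, y) \<in> E \<Longrightarrow> (g x, g y) \<in> E"
proof -
  have E: "equiv X E"
    and convex: "\<forall>x y z. (x, z) \<in> E \<longrightarrow> y \<in> X \<longrightarrow> x \<le> y \<longrightarrow> y \<le> z \<longrightarrow> (x, y) \<in> E"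
    and invariant: "\<forall>g\<in>G. \<forall>x y. (x, y) \<in> E \<longrightarrow> (g x, g y) \<in> E"
    using assms unfolding congruence_def by simp_all
  show "(x, y) \<in> E \<Longrightarrow> x \<in> X \<and> y \<in> X" using equiv_type[OF E] by blast
  show "x \<in> X \<Longrightarrow> (x, x) \<in> E" using E by (meson equivE refl_onD)
  show "(x, y) \<in> E \<Longrightarrow> (y, x) \<in> E" using E by (meson equivE symD)
  show "(x, y) \<in> E \<Longrightarrow> (y, z) \<in> E \<Longrightarrow> (x, z) \<in> E" using E by (meson equivE transD)
  show "(x, z) \<in> E \<Longrightarrow> y \<in> X \<Longrightarrow> x \<le> y \<Longrightarrow> y \<le> z \<Longrightarrow> (x, y) \<in> E" using convex by metis
  show "g \<in> G \<Longrightarrow> (x, y) \<in> E \<Longrightarrow> (g x, g y) \<in> E" using invariant by metis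
qed

lemma congruenceI:
  assumes "\<And>x y. (x, y) \<in> E \<Longrightarrow> x \<in> X \<and> y \<in> X"
    and "\<And>x. x \<in> X \<Longrightarrow> (x, x) \<in> E"
    and "\<And>x y. (x, y) \<in> E \<Longrightarrow> (y, x) \<in> E"
    and "\<And>x y z. (x, y) \<in> E \<Longrightarrow> (y, z) \<in> E \<Longrightarrow> (x, z) \<in> E"
    and "\<And>x y z. (x, z) \<in> E \<Longrightarrow> y \<in> X \<Longrightarrow> x \<le> y \<Longrightarrow> y \<le> z \<Longrightarrow> (x, y) \<in> E"
    and "\<And>g x y. g \<in> G \<Longrightarrow> (x, y) \<in> E \<Longrightarrow> (g x, g y) \<in> E"
  shows "congruence E"
  unfolding congruence_def
proof (intro conjI)
  show "equiv X E"
  proof (rule equivI)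
    show "E \<subseteq> X \<times> X" using assms(1) by auto
    show "refl_on X E" using assms(2) by (rule refl_onI)
    show "sym E" using assms(3) by (rule symI)
    show "trans E" using assms(4) by (rule transI)
  qed
  show "\<forall>x y z. (x, z) \<in> E \<longrightarrow> y \<in> X \<longrightarrow> x \<le> y \<longrightarrow> y \<le> z \<longrightarrow> (x, y) \<in> E"
    by (intro allI impI) (rule assms(5))
  show "\<forall>g\<in>G. \<forall>x y. (x, y) \<in> E \<longrightarrow> (g x, g y) \<in> E"
    by (intro allI ballI impI) (rule assms(6))
qed

lemma congruence_convex_right:
  assumes "congruence E" "(x, z) \<in> E" "y \<in> X" "x \<le> y" "y \<le> z"
  shows "(y, z) \<in> E"
  using cong_trans[OF assms(1) cong_sym[OF assms(1) cong_convex[OF assms]] assms(2)] .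

lemma congruence_invariant_iff:
  assumes "congruence E" "g \<in> G" "x \<in> X" "y \<in> X"
  shows "(g x, g y) \<in> E \<longleftrightarrow> (x, y) \<in> E"
proof -
  obtain h where h: "h \<in> G" "h (g x) = x" "h (g y) = y" using inverse[OF assms(2)] assms(3,4) by blast
  show ?thesis
    using cong_invariant[OF assms(1,2), of x y] cong_invariant[OF assms(1) h(1), of "g x" "g y"] h
    by auto
qed

lemma mono_iff:
  assumes "g \<in> G" "x \<in> X" "y \<in> X"
  shows "g x < g y \<longleftrightarrow> x < y"
  using mono[OF assms] mono[OF assms(1,3,2)] by (cases x y rule: linorder_cases) auto

section \<open>Comparability, intersections and unions of congruences\<close>

lemma congruence_Id: "congruence (Id_on X)"
proof (rule congruenceI)
  show "(g x, g y) \<in> Id_on X" if "g \<in> G" "(x, y) \<in> Id_on X" for g x y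
    using maps[OF that(1)] that(2) by auto
qed auto

lemma congruence_Inter:
  assumes "\<E> \<noteq> {}" "\<And>E. E \<in> \<E> \<Longrightarrow> congruence E"
  shows "congruence (\<Inter>\<E>)"
proof (rule congruenceI)
  show "x \<in> X \<and> y \<in> X" if "(x, y) \<in> \<Inter>\<E>" for x y
    using that assms by (meson InterE cong_sub ex_in_conv)
next
  show "\<And>x. x \<in> X \<Longrightarrow> (x, x) \<in> \<Inter>\<E>" using assms(2) cong_refl by blast
  show "\<And>x y. (x, y) \<in> \<Inter>\<E> \<Longrightarrow> (y, x) \<in> \<Inter>\<E>" using assms(2) cong_sym by (metis InterD InterI)
  show "\<And>x y z. (x, y) \<in> \<Inter>\<E> \<Longrightarrow> (y, z) \<in> \<Inter>\<E> \<Longrightarrow> (x, z) \<in> \<Inter>\<E>"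
    using assms(2) cong_trans by (metis InterD InterI)
  show "\<And>x y z. (x, z) \<in> \<Inter>\<E> \<Longrightarrow> y \<in> X \<Longrightarrow> x \<le> y \<Longrightarrow> y \<le> z \<Longrightarrow> (x, y) \<in> \<Inter>\<E>"
    using assms(2) cong_convex by (metis InterD InterI)
  show "\<And>g x y. g \<in> G \<Longrightarrow> (x, y) \<in> \<Inter>\<E> \<Longrightarrow> (g x, g y) \<in> \<Inter>\<E>"
    using assms(2) cong_invariant by (metis InterD InterI)
qed

text \<open>If \<open>y < x < z\<close> with \<open>y, x\<close> related by \<open>E\<close> only and \<open>x, z\<close> by \<open>F\<close> only, an automorphism that
  moves \<open>x\<close> to \<open>y\<close> sends \<open>z\<close> strictly between \<open>y\<close> and \<open>x\<close>, where \<open>E\<close> relates it to \<open>y\<close>.\<close>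

lemma congruence_no_crossing:
  assumes E: "congruence E" and F: "congruence F"
    and yx: "(y, x) \<in> E" "(y, x) \<notin> F" and xz: "(x, z) \<in> F" "(x, z) \<notin> E"
    and less: "y < x" "x < z"
  shows False
proof -
  have X: "x \<in> X" "y \<in> X" "z \<in> X" using cong_sub[OF E yx(1)] cong_sub[OF F xz(1)] by auto
  obtain g where g: "g \<in> G" "g x = y" using transitive X by metis
  have gz: "(y, g z) \<in> F" "(y, g z) \<notin> E" "g z \<in> X" "y < g z"
    using congruence_invariant_iff[OF E g(1) X(1,3)] congruence_invariant_iff[OF F g(1) X(1,3)]
      mono_iff[OF g(1) X(1,3)] g xz X less maps[OF g(1)] by auto
  show False
  proof (cases "g z \<le> x")
    case True
    then show False using cong_convex[OF E yx(1) gz(3) less_imp_le[OF gz(4)]] gz(2) by simp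
  next
    case False
    then show False using cong_convex[OF F gz(1) X(1) less_imp_le[OF less(1)]] yx(2) linear by blast
  qed
qed

lemma congruence_sym_less:
  assumes E: "congruence E" and F: "congruence F" and "\<not> E \<subseteq> F"
  obtains x y where "(x, y) \<in> E" "(x, y) \<notin> F" "x < y"
proof -
  obtain x y where xy: "(x, y) \<in> E" "(x, y) \<notin> F" using assms(3) by auto
  then have "x \<noteq> y" using cong_sub[OF E] cong_refl[OF F] by blast
  then show thesis using that xy cong_sym[OF E] cong_sym[OF F] by (metis neq_iff)
qed

text \<open>Two incomparable congruences each relate an increasing pair that the other separates.
  Transitivity moves one pair so that it starts where the other ends, and this is the forbidden
  crossing.\<close>

lemma congruence_linear:
  assumes E: "congruence E" and F: "congruence F"
  shows "E \<subseteq> F \<or> F \<subseteq> E"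
proof (rule ccontr)
  assume "\<not> ?thesis"
  then obtain y x x' z where yx: "(y, x) \<in> E" "(y, x) \<notin> F" "y < x"
    and xz: "(x', z) \<in> F" "(x', z) \<notin> E" "x' < z"
    using congruence_sym_less[OF E F] congruence_sym_less[OF F E] by metis
  have X: "x \<in> X" "x' \<in> X" "z \<in> X" using cong_sub[OF E yx(1)] cong_sub[OF F xz(1)] by auto
  obtain g where g: "g \<in> G" "g x' = x" using transitive X by metis
  show False
    using congruence_no_crossing[OF E F yx(1,2), of "g z"] yx xz g X
      congruence_invariant_iff[OF E g(1) X(2,3)] congruence_invariant_iff[OF F g(1) X(2,3)]
      mono_iff[OF g(1) X(2,3)] by auto
qed

text \<open>Transitivity of the union is the point that depends on congruences forming a chain: the
  two members involved are comparable.\<close>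

lemma congruence_Union:
  assumes ne: "\<E> \<noteq> {}" and cong: "\<And>E. E \<in> \<E> \<Longrightarrow> congruence E"
  shows "congruence (\<Union>\<E>)"
proof (rule congruenceI)
  fix x y z assume "(x, y) \<in> \<Union>\<E>" "(y, z) \<in> \<Union>\<E>"
  then obtain E F where EF: "E \<in> \<E>" "F \<in> \<E>" "(x, y) \<in> E" "(y, z) \<in> F" by blast
  then have "E \<subseteq> F \<or> F \<subseteq> E" using congruence_linear cong by blast
  then have "(x, z) \<in> E \<or> (x, z) \<in> F" using EF cong cong_trans by blast
  then show "(x, z) \<in> \<Union>\<E>" using EF by blast
next
  fix x assume "x \<in> X"
  then show "(x, x) \<in> \<Union>\<E>" using ne cong cong_refl by blast
next
  show "\<And>x y. (x, y) \<in> \<Union>\<E> \<Longrightarrow> x \<in> X \<and> y \<in> X" using cong cong_sub by (metis UnionE)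
  show "\<And>x y. (x, y) \<in> \<Union>\<E> \<Longrightarrow> (y, x) \<in> \<Union>\<E>" using cong cong_sym by (metis UnionE UnionI)
  show "\<And>x y z. (x, z) \<in> \<Union>\<E> \<Longrightarrow> y \<in> X \<Longrightarrow> x \<le> y \<Longrightarrow> y \<le> z \<Longrightarrow> (x, y) \<in> \<Union>\<E>"
    using cong cong_convex by (metis UnionE UnionI)
  show "\<And>g x y. g \<in> G \<Longrightarrow> (x, y) \<in> \<Union>\<E> \<Longrightarrow> (g x, g y) \<in> \<Union>\<E>"
    using cong cong_invariant by (metis UnionE UnionI)
qed

text \<open>Taking the point of least index makes the choice coherent between congruences: the
  representative of a class also represents every smaller class that contains it. As representatives
  are points of \<open>X\<close>, the quotient becomes a subset of the same linear order.\<close>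

definition rep :: "('a \<times> 'a) set \<Rightarrow> 'a \<Rightarrow> 'a" where
  "rep E x = (ARG_MIN (to_nat_on X) y. (x, y) \<in> E)"

lemma
  assumes "congruence E" "x \<in> X"
  shows rep_rel: "(x, rep E x) \<in> E"
    and rep_least: "(x, y) \<in> E \<Longrightarrow> to_nat_on X (rep E x) \<le> to_nat_on X y"
  using arg_min_nat_lemma[of "\<lambda>y. (x, y) \<in> E", OF cong_refl[OF assms]]
  by (auto simp: rep_def)

lemma rep_in: "congruence E \<Longrightarrow> x \<in> X \<Longrightarrow> rep E x \<in> X"
  using rep_rel cong_sub by blast

lemma rep_eq_iff:
  assumes E: "congruence E" and x: "x \<in> X" and y: "y \<in> X"
  shows "rep E x = rep E y \<longleftrightarrow> (x, y) \<in> E"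
proof
  assume "rep E x = rep E y"
  then show "(x, y) \<in> E" using rep_rel[OF E x] rep_rel[OF E y] by (metis E cong_sym cong_trans)
next
  assume "(x, y) \<in> E"
  then have "(x, z) \<in> E \<longleftrightarrow> (y, z) \<in> E" for z by (metis E cong_sym cong_trans)
  then show "rep E x = rep E y" by (simp add: rep_def)
qed

lemma rep_idem: "congruence E \<Longrightarrow> x \<in> X \<Longrightarrow> rep E (rep E x) = rep E x"
  using rep_eq_iff[of E x "rep E x"] rep_rel[of E x] rep_in[of E x] by simp

lemma rep_eqI:
  assumes E: "congruence E" and x: "x \<in> X"
    and least: "\<And>y. (x, y) \<in> E \<Longrightarrow> to_nat_on X x \<le> to_nat_on X y"
  shows "rep E x = x"
proof -
  have "to_nat_on X (rep E x) = to_nat_on X x"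
    using least[OF rep_rel[OF E x]] rep_least[OF E x cong_refl[OF E x]] by simp
  then show ?thesis using countable_X rep_in[OF E x] x by (simp add: to_nat_on_inj)
qed

text \<open>Distinct convex classes compare as wholes, so any choice of representatives preserves
  their order.\<close>

lemma rep_less:
  assumes E: "congruence E" and x: "x \<in> X" and y: "y \<in> X" and "x < y" "(x, y) \<notin> E"
  shows "rep E x < rep E y"
proof (rule ccontr)
  assume le: "\<not> rep E x < rep E y"
  let ?x = "rep E x" and ?y = "rep E y"
  have R: "(x, ?x) \<in> E" "(?y, y) \<in> E" "?x \<in> X" "?y \<in> X"
    using rep_rel rep_in cong_sym E x y by blast+
  show False
  proof (cases "x \<le> ?y")
    case True
    then have "(x, ?y) \<in> E" using cong_convex[OF E R(1,4)] le by simp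
    then show False using R(2) assms(5) E cong_trans by blast
  next
    case False
    then have "(x, y) \<in> E" using congruence_convex_right[OF E R(2) x] assms(4) by simp
    then show False using assms(5) by simp
  qed
qed

lemma rep_le_iff:
  assumes E: "congruence E" and x: "x \<in> X" and y: "y \<in> X"
  shows "rep E x \<le> rep E y \<longleftrightarrow> x \<le> y \<or> (x, y) \<in> E"
  using rep_less[OF E x y] rep_less[OF E y x] rep_eq_iff[OF E x y] cong_sym[OF E, of y x]
  by (cases x y rule: linorder_cases) force+

lemma rep_less_iff:
  assumes E: "congruence E" and x: "x \<in> X" and y: "y \<in> X"
  shows "rep E x < rep E y \<longleftrightarrow> x < y \<and> (x, y) \<notin> E"
  using rep_le_iff[OF E y x] cong_sym[OF E, of x y] cong_sym[OF E, of y x] by (auto simp flip: not_le)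

text \<open>The finite condensation of the quotient by \<open>E\<close>, pulled back to
  \<open>X\<close>. One of the two intervals has at most one point; naming both makes the relation
  symmetric without cases on the order of \<open>x\<close> and \<open>y\<close>.\<close>

definition steps :: "('a \<times> 'a) set \<Rightarrow> ('a \<times> 'a) set" where
  "steps E = {(x, y). x \<in> X \<and> y \<in> X \<and>
     finite (rep E ` X \<inter> {rep E x..rep E y}) \<and> finite (rep E ` X \<inter> {rep E y..rep E x})}"

text \<open>An automorphism need not send representatives to representatives, so the target interval
  is covered by the images under \<open>rep E (g q)\<close> instead of \<open>g q\<close>.\<close>

lemma finite_rep_interval_image:
  assumes E: "congruence E" and g: "g \<in> G" and x: "x \<in> X" and y: "y \<in> X"
    and fin: "finite (rep E ` X \<inter> {rep E x..rep E y})"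
  shows "finite (rep E ` X \<inter> {rep E (g x)..rep E (g y)})"
proof (rule finite_subset[OF _ finite_imageI[OF fin, of "\<lambda>q. rep E (g q)"]], rule subsetI)
  fix q assume "q \<in> rep E ` X \<inter> {rep E (g x)..rep E (g y)}"
  then have q: "q \<in> X" "rep E q = q" "rep E (g x) \<le> rep E q" "rep E q \<le> rep E (g y)"
    using rep_in[OF E] rep_idem[OF E] by auto
  obtain h where h: "h \<in> G" "\<And>x. x \<in> X \<Longrightarrow> h (g x) = x" "\<And>x. x \<in> X \<Longrightarrow> g (h x) = x"
    using inverse[OF g] by blast
  have iff: "rep E (g u) \<le> rep E (g v) \<longleftrightarrow> rep E u \<le> rep E v" if "u \<in> X" "v \<in> X" for u v
    using rep_le_iff[OF E] congruence_invariant_iff[OF E g that] mono_iff[OF g that(2,1)] maps[OF g] that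
    by (metis linorder_not_le)
  have hq: "h q \<in> X" "g (h q) = q" using h(3) q(1) maps[OF h(1)] by auto
  have "rep E x \<le> rep E (h q)" "rep E (h q) \<le> rep E y"
    using iff[OF x hq(1)] iff[OF hq(1) y] q hq by auto
  moreover have "rep E (g (rep E (h q))) = q"
  proof -
    have "(g (h q), g (rep E (h q))) \<in> E"
      using cong_invariant[OF E g] rep_rel[OF E hq(1)] by blast
    then show ?thesis using rep_eq_iff[OF E] cong_sub[OF E] hq(2) q(2) by metis
  qed
  ultimately show "q \<in> (\<lambda>q. rep E (g q)) ` (rep E ` X \<inter> {rep E x..rep E y})"
    using hq by (intro image_eqI[of _ _ "rep E (h q)"]) auto
qed

lemma congruence_steps:
  assumes E: "congruence E"
  shows "congruence (steps E)"
proof (rule congruenceI)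
  fix x y z assume xy: "(x, y) \<in> steps E" and yz: "(y, z) \<in> steps E"
  have "rep E ` X \<inter> {rep E x..rep E z} \<subseteq> rep E ` X \<inter> {rep E x..rep E y} \<union> rep E ` X \<inter> {rep E y..rep E z}"
    "rep E ` X \<inter> {rep E z..rep E x} \<subseteq> rep E ` X \<inter> {rep E z..rep E y} \<union> rep E ` X \<inter> {rep E y..rep E x}"
    by auto
  moreover have "finite (rep E ` X \<inter> {rep E x..rep E y} \<union> rep E ` X \<inter> {rep E y..rep E z})"
    "finite (rep E ` X \<inter> {rep E z..rep E y} \<union> rep E ` X \<inter> {rep E y..rep E x})"
    using xy yz by (simp_all add: steps_def)
  ultimately show "(x, z) \<in> steps E"
    using xy yz by (simp add: steps_def finite_subset)
next
  fix x y z assume xz: "(x, z) \<in> steps E" and y: "y \<in> X" "x \<le> y" "y \<le> z"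
  have X: "x \<in> X" "z \<in> X" using xz by (auto simp: steps_def)
  have r: "rep E x \<le> rep E y" "rep E y \<le> rep E z"
    using rep_le_iff[OF E] X y by blast+
  then have "rep E ` X \<inter> {rep E x..rep E y} \<subseteq> rep E ` X \<inter> {rep E x..rep E z}"
    "rep E ` X \<inter> {rep E y..rep E x} \<subseteq> {rep E x}" by auto
  moreover have "finite (rep E ` X \<inter> {rep E x..rep E z})" using xz by (simp add: steps_def)
  ultimately have "finite (rep E ` X \<inter> {rep E x..rep E y})" "finite (rep E ` X \<inter> {rep E y..rep E x})"
    by (meson finite_subset finite.emptyI finite.insertI)+
  then show "(x, y) \<in> steps E" using X y by (simp add: steps_def)
next
  fix g x y assume g: "g \<in> G" and "(x, y) \<in> steps E"
  then show "(g x, g y) \<in> steps E"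
    using finite_rep_interval_image[OF E g] maps[OF g] by (auto simp: steps_def)
qed (auto simp: steps_def)

lemma subset_steps:
  assumes E: "congruence E"
  shows "E \<subseteq> steps E"
proof clarify
  fix x y assume xy: "(x, y) \<in> E"
  then have "rep E x = rep E y" "x \<in> X" "y \<in> X"
    using rep_eq_iff[OF E] cong_sub[OF E] by blast+
  then show "(x, y) \<in> steps E" by (simp add: steps_def)
qed

section \<open>Neighbouring classes\<close>

definition adjacent :: "('a \<times> 'a) set \<Rightarrow> 'a \<Rightarrow> 'a \<Rightarrow> bool" where
  "adjacent E x z \<longleftrightarrow> x \<in> X \<and> z \<in> X \<and> x < z \<and> (x, z) \<notin> E \<and>
     (\<forall>y\<in>X. x < y \<longrightarrow> y < z \<longrightarrow> (x, y) \<in> E \<or> (y, z) \<in> E)"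

lemma adjacent_image:
  assumes E: "congruence E" and g: "g \<in> G" and adj: "adjacent E x z"
  shows "adjacent E (g x) (g z)"
proof -
  have X: "x \<in> X" "z \<in> X" using adj by (auto simp: adjacent_def)
  obtain h where h: "h \<in> G" "\<And>x. x \<in> X \<Longrightarrow> h (g x) = x" "\<And>x. x \<in> X \<Longrightarrow> g (h x) = x"
    using inverse[OF g] by blast
  have "(g x, y) \<in> E \<or> (y, g z) \<in> E" if y: "y \<in> X" "g x < y" "y < g z" for y
  proof -
    have hy: "h y \<in> X" "g (h y) = y" using h(3) y(1) maps[OF h(1)] by auto
    then have "(x, h y) \<in> E \<or> (h y, z) \<in> E"
      using adj mono_iff[OF g X(1) hy(1)] mono_iff[OF g hy(1) X(2)] y by (auto simp: adjacent_def)
    then show ?thesis using cong_invariant[OF E g] hy(2) by metis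
  qed
  then show ?thesis
    using adj X maps[OF g] mono[OF g] congruence_invariant_iff[OF E g X] by (auto simp: adjacent_def)
qed

text \<open>Two distinct classes with finitely many between them yield one adjacent pair.
  Transitivity carries either of its ends to any given point, so every class has both a successor
  and a predecessor.\<close>

lemma ex_adjacent:
  assumes E: "congruence E" and ne: "steps E \<noteq> E" and w: "w \<in> X"
  shows ex_next: "\<exists>z. adjacent E w z" and ex_prev: "\<exists>z. adjacent E z w"
proof -
  have "\<not> steps E \<subseteq> E" using ne subset_steps[OF E] by blast
  then obtain x y where xy: "(x, y) \<in> steps E" "(x, y) \<notin> E" "x < y"
    using congruence_sym_less[OF congruence_steps[OF E] E] by metis
  then have X: "x \<in> X" "y \<in> X" by (auto simp: steps_def)
  \<comment> \<open>The left end is excluded, so the minimum of \<open>S\<close> represents the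
    class right after that of \<open>x\<close>.\<close>
  define S where "S = rep E ` X \<inter> {rep E x<..rep E y}"
  have fin: "finite S"
    by (rule finite_subset[of _ "rep E ` X \<inter> {rep E x..rep E y}"]) (use xy(1) in \<open>auto simp: S_def steps_def\<close>)
  have "rep E y \<in> S" using rep_less[OF E X] xy X by (auto simp: S_def)
  then have z: "Min S \<in> S" using fin Min_in by blast
  define z where "z = Min S"
  have z: "z \<in> X" "rep E z = z" "rep E x < rep E z"
    using z rep_in[OF E] rep_idem[OF E] unfolding S_def z_def by auto
  have xz: "x < z" "(x, z) \<notin> E" using z rep_less_iff[OF E X(1) z(1)] by auto
  have "(x, u) \<in> E \<or> (u, z) \<in> E" if u: "u \<in> X" "x < u" "u < z" for u
  proof (rule disjCI)
    assume "(u, z) \<notin> E"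
    then have "rep E u < z" using rep_less[OF E u(1) z(1) u(3)] z(2) by simp
    then have "rep E u \<notin> S" using fin unfolding z_def by (metis Min_le leD)
    moreover have "rep E u \<le> rep E y"
      using \<open>rep E u < z\<close> \<open>Min S \<in> S\<close> unfolding S_def z_def by auto
    ultimately have "\<not> rep E x < rep E u" using u by (auto simp: S_def)
    then show "(x, u) \<in> E" using rep_less_iff[OF E X(1) u(1)] u by auto
  qed
  then have adj: "adjacent E x z" using X z xz by (simp add: adjacent_def)
  obtain g h where "g \<in> G" "g x = w" "h \<in> G" "h z = w" using transitive X(1) z(1) w by metis
  then show "\<exists>z. adjacent E w z" "\<exists>z. adjacent E z w"
    using adjacent_image[OF E _ adj] by metis+
qed

lemma adjacent_rep_interval:
  assumes E: "congruence E" and adj: "adjacent E x z"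
  shows "rep E ` X \<inter> {rep E x<..rep E z} = {rep E z}" and "rep E x < rep E z"
proof -
  have X: "x \<in> X" "z \<in> X" "x < z" "(x, z) \<notin> E" using adj by (auto simp: adjacent_def)
  then show less: "rep E x < rep E z" using rep_less[OF E] by blast
  have "rep E u = rep E z" if u: "u \<in> X" "rep E x < rep E u" "rep E u \<le> rep E z" for u
  proof (rule ccontr)
    assume "rep E u \<noteq> rep E z"
    then have "x < u" "u < z" "(x, u) \<notin> E" "(u, z) \<notin> E"
      using rep_less_iff[OF E] u X by (meson order.not_eq_order_implies_strict)+
    then show False using adj u by (auto simp: adjacent_def)
  qed
  then show "rep E ` X \<inter> {rep E x<..rep E z} = {rep E z}" using less X by auto
qed

lemma adjacent_steps:
  assumes E: "congruence E" and adj: "adjacent E x z"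
  shows "(x, z) \<in> steps E"
proof -
  have X: "x \<in> X" "z \<in> X" using adj by (auto simp: adjacent_def)
  have "rep E ` X \<inter> {rep E x..rep E z} \<subseteq> insert (rep E x) (rep E ` X \<inter> {rep E x<..rep E z})"
    by auto
  then have "finite (rep E ` X \<inter> {rep E x..rep E z})"
    using adjacent_rep_interval(1)[OF E adj] by (simp add: finite_subset)
  moreover have "{rep E z..rep E x} = {}" using adjacent_rep_interval(2)[OF E adj] by simp
  ultimately show ?thesis using X by (simp add: steps_def)
qed

lemma adjacent_unique:
  assumes E: "congruence E" and "adjacent E x z" "adjacent E x w"
  shows "(z, w) \<in> E"
proof -
  have *: "(z, w) \<in> E" if "adjacent E x z" "adjacent E x w" "z < w" for z w
    using that unfolding adjacent_def by blast
  show ?thesis using assms *[of z w] *[of w z] cong_sym[OF E] cong_refl[OF E]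
    by (metis adjacent_def neq_iff)
qed

text \<open>Thus \<open>steps E\<close>, if different from \<open>E\<close>, is the immediate
  successor of \<open>E\<close> among the congruences. A strictly larger \<open>F\<close> merges
  some pair of adjacent classes, hence by transitivity all of them, and then also classes finitely
  many steps apart.\<close>

lemma steps_subset:
  assumes E: "congruence E" and F: "congruence F" and EF: "E \<subset> F" and ne: "steps E \<noteq> E"
  shows "steps E \<subseteq> F"
proof -
  have adj_F: "(x, z) \<in> F" if adj: "adjacent E x z" for x z
  proof -
    obtain a b where ab: "(a, b) \<in> F" "(a, b) \<notin> E" "a < b"
      using congruence_sym_less[OF F E] EF by blast
    have X: "a \<in> X" "b \<in> X" "x \<in> X" "z \<in> X" using cong_sub[OF F ab(1)] adj by (auto simp: adjacent_def)
    obtain c where c: "adjacent E a c" using ex_next[OF E ne X(1)] by blast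
    \<comment> \<open>The class following that of \<open>a\<close> is met on the way to
      \<open>b\<close>: either \<open>c\<close> comes no later than \<open>b\<close>, or
      \<open>b\<close> already lies in the class of \<open>c\<close>.\<close>
    have "(a, c) \<in> F"
    proof (cases "c \<le> b")
      case True
      then show ?thesis using cong_convex[OF F ab(1)] c by (auto simp: adjacent_def)
    next
      case False
      then have "(b, c) \<in> E" using c ab X by (auto simp: adjacent_def)
      then show ?thesis using EF ab(1) cong_trans[OF F] by blast
    qed
    obtain g where g: "g \<in> G" "g a = x" using transitive X by metis
    have "(x, g c) \<in> F" using cong_invariant[OF F g(1) \<open>(a, c) \<in> F\<close>] g by simp
    moreover have "(g c, z) \<in> E"
      using adjacent_unique[OF E _ adj] adjacent_image[OF E g(1) c] g by simp
    ultimately show ?thesis using EF cong_trans[OF F] by blast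
  qed
  show ?thesis
  proof (rule ccontr)
    assume "\<not> ?thesis"
    then obtain x y where xy: "(x, y) \<in> steps E" "(x, y) \<notin> F" "x < y"
      using congruence_sym_less[OF congruence_steps[OF E] F] by blast
    then have X: "x \<in> X" "y \<in> X" by (auto simp: steps_def)
    \<comment> \<open>The classes up to that of \<open>y\<close> that \<open>F\<close> merges with
      that of \<open>x\<close>. The class after the last of them would again be one of them.\<close>
    define S where "S = {q \<in> rep E ` X \<inter> {rep E x..rep E y}. (x, q) \<in> F}"
    have rep_F: "(u, rep E u) \<in> F" if "u \<in> X" for u using rep_rel[OF E that] EF by blast
    have fin: "finite S"
      by (rule finite_subset[of _ "rep E ` X \<inter> {rep E x..rep E y}"])
        (use xy(1) in \<open>auto simp: S_def steps_def\<close>)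
    have "rep E x \<in> S" using rep_le_iff[OF E X] xy X rep_F by (auto simp: S_def)
    then have "Max S \<in> S" using fin Max_in by blast
    then obtain q where q: "q = Max S" "q \<in> X" "rep E q = q" "rep E x \<le> q" "q \<le> rep E y" "(x, q) \<in> F"
      using rep_in[OF E] rep_idem[OF E] unfolding S_def by auto
    have "q \<noteq> rep E y" using q xy(2) rep_F[OF X(2)] by (metis F cong_sym cong_trans)
    then have qy: "q < rep E y" using q by simp
    obtain z where z: "adjacent E q z" using ex_next[OF E ne q(2)] by blast
    then have zX: "z \<in> X" by (simp add: adjacent_def)
    have "(x, rep E z) \<in> F" using q(6) adj_F[OF z] rep_F[OF zX] by (metis F cong_trans)
    moreover have "q < rep E z" using adjacent_rep_interval(2)[OF E z] q by simp
    moreover have "rep E z \<le> rep E y"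
    proof (rule ccontr)
      assume "\<not> rep E z \<le> rep E y"
      then have "rep E y \<in> rep E ` X \<inter> {rep E q<..rep E z}" using qy q X by auto
      then show False
        using adjacent_rep_interval(1)[OF E z] \<open>\<not> rep E z \<le> rep E y\<close> by auto
    qed
    ultimately have "rep E z \<in> S" using q zX by (auto simp: S_def)
    then show False using Max_ge[OF fin] \<open>q < rep E z\<close> q(1) by (metis leD)
  qed
qed

end

subsection \<open>Coordinates in a power of the integers\<close>

text \<open>At most one of the two cardinalities is nonzero, so for locally finite \<open>Q\<close>
  this is the signed number of steps from \<open>a\<close> to \<open>b\<close>. Half-open intervals
  make it additive.\<close>

definition signed_count :: "'a::linorder set \<Rightarrow> 'a \<Rightarrow> 'a \<Rightarrow> int" where
  "signed_count Q a b = int (card (Q \<inter> {a<..b})) - int (card (Q \<inter> {b<..a}))"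

lemma signed_count_trans:
  assumes fin: "\<And>u v. u \<in> {a, b, c} \<Longrightarrow> v \<in> {a, b, c} \<Longrightarrow> finite (Q \<inter> {u..v})"
  shows "signed_count Q a c = signed_count Q a b + signed_count Q b c"
proof -
  have split: "card (Q \<inter> {u<..w}) = card (Q \<inter> {u<..v}) + card (Q \<inter> {v<..w})"
    if "u \<in> {a, b, c}" "v \<in> {a, b, c}" "w \<in> {a, b, c}" "u \<le> v" "v \<le> w" for u v w
  proof -
    have "finite (Q \<inter> {u<..v})" "finite (Q \<inter> {v<..w})"
      by (rule finite_subset[OF _ fin[OF that(1,2)]], force)
        (rule finite_subset[OF _ fin[OF that(2,3)]], force)
    moreover have "Q \<inter> {u<..w} = Q \<inter> {u<..v} \<union> Q \<inter> {v<..w}"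
      "Q \<inter> {u<..v} \<inter> (Q \<inter> {v<..w}) = {}"
      using that by auto
    ultimately show ?thesis by (metis card_Un_disjoint)
  qed
  have zero: "card (Q \<inter> {u<..v}) = 0" if "v \<le> u" for u v using that by simp
  \<comment> \<open>In each of the six possible orders of the three points, the longest interval
    splits at the middle point.\<close>
  consider "a \<le> b" "b \<le> c" | "a \<le> c" "c \<le> b" | "b \<le> a" "a \<le> c"
    | "b \<le> c" "c \<le> a" | "c \<le> a" "a \<le> b" | "c \<le> b" "b \<le> a"
    by (meson linear)
  then show ?thesis
  proof cases
    case 1
    then show ?thesis
      using split[of a b c] zero[of a b] zero[of b c] zero[of a c] unfolding signed_count_def by auto
  next
    case 2
    then show ?thesis
      using split[of a c b] zero[of a c] zero[of c b] zero[of a b] unfolding signed_count_def by auto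
  next
    case 3
    then show ?thesis
      using split[of b a c] zero[of b a] zero[of a c] zero[of b c] unfolding signed_count_def by auto
  next
    case 4
    then show ?thesis
      using split[of b c a] zero[of b c] zero[of c a] zero[of b a] unfolding signed_count_def by auto
  next
    case 5
    then show ?thesis
      using split[of c a b] zero[of c a] zero[of a b] zero[of c b] unfolding signed_count_def by auto
  next
    case 6
    then show ?thesis
      using split[of c b a] zero[of c b] zero[of b a] zero[of c a] unfolding signed_count_def by auto
  qed
qed

context transitive_chain
begin

section \<open>Signed distances between classes\<close>

definition class_count :: "('a \<times> 'a) set \<Rightarrow> 'a \<Rightarrow> 'a \<Rightarrow> int" where
  "class_count E x y = signed_count (rep E ` X) (rep E x) (rep E y)"

lemma class_count_trans:
  assumes "congruence E" "(x, y) \<in> steps E" "(y, z) \<in> steps E"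
  shows "class_count E x z = class_count E x y + class_count E y z"
proof -
  have "(x, z) \<in> steps E" using cong_trans[OF congruence_steps] assms by metis
  then have "finite (rep E ` X \<inter> {u..v})" if "u \<in> rep E ` {x, y, z}" "v \<in> rep E ` {x, y, z}" for u v
    using assms(2,3) that by (auto simp: steps_def)
  then show ?thesis unfolding class_count_def by (intro signed_count_trans) auto
qed

lemma class_count_eq_0: "congruence E \<Longrightarrow> (x, y) \<in> E \<Longrightarrow> class_count E x y = 0"
  using rep_eq_iff[of E x y] cong_sub[of E x y] by (simp add: class_count_def signed_count_def)

lemma class_count_pos:
  assumes E: "congruence E" and xy: "(x, y) \<in> steps E" "(x, y) \<notin> E" "x < y"
  shows "0 < class_count E x y"
proof -
  have X: "x \<in> X" "y \<in> X" using xy by (auto simp: steps_def)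
  have less: "rep E x < rep E y" using rep_less[OF E X] xy by blast
  have "finite (rep E ` X \<inter> {rep E x<..rep E y})"
    by (rule finite_subset[of _ "rep E ` X \<inter> {rep E x..rep E y}"]) (use xy(1) in \<open>auto simp: steps_def\<close>)
  moreover have "rep E y \<in> rep E ` X \<inter> {rep E x<..rep E y}" using X less by auto
  ultimately have "0 < card (rep E ` X \<inter> {rep E x<..rep E y})" using card_gt_0_iff by blast
  then show ?thesis using less by (simp add: class_count_def signed_count_def)
qed

lemma class_count_adjacent:
  assumes "congruence E" "adjacent E x y"
  shows "class_count E x y = 1" "class_count E y x = -1"
  using adjacent_rep_interval[OF assms] by (simp_all add: class_count_def signed_count_def)

text \<open>Moving to the next or previous class changes the count by one. Since both moves are
  always possible, the classes in a \<open>steps E\<close>-class have order type zeta and not that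
  of a finite or one-sided chain.\<close>

lemma class_count_surj:
  assumes E: "congruence E" and ne: "steps E \<noteq> E" and x: "x \<in> X"
  shows "\<exists>y. (x, y) \<in> steps E \<and> class_count E x y = k"
proof (induction k rule: int_induct[of _ 0])
  case base
  have "(x, x) \<in> steps E" "(x, x) \<in> E" using cong_refl E congruence_steps x by blast+
  then show ?case using class_count_eq_0[OF E] by blast
next
  case (step1 k)
  then obtain y where y: "(x, y) \<in> steps E" "class_count E x y = k" by blast
  then have "y \<in> X" by (simp add: steps_def)
  then obtain z where "adjacent E y z" using ex_next[OF E ne] by blast
  then have "(y, z) \<in> steps E" "class_count E y z = 1"
    using adjacent_steps[OF E] class_count_adjacent[OF E] by blast+
  then show ?case using class_count_trans[OF E y(1)] cong_trans[OF congruence_steps[OF E] y(1)] y(2)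
    by metis
next
  case (step2 k)
  then obtain y where y: "(x, y) \<in> steps E" "class_count E x y = k" by blast
  then have "y \<in> X" by (simp add: steps_def)
  then obtain z where "adjacent E z y" using ex_prev[OF E ne] by blast
  then have "(y, z) \<in> steps E" "class_count E y z = -1"
    using adjacent_steps[OF E] class_count_adjacent[OF E] cong_sym[OF congruence_steps[OF E]] by blast+
  then have "(x, z) \<in> steps E" "class_count E x z = k - 1"
    using class_count_trans[OF E y(1)] cong_trans[OF congruence_steps[OF E] y(1)] y(2) by auto
  then show ?case by blast
qed

text \<open>The \<open>E\<close>-classes inside a \<open>steps E\<close>-class form a copy of Z
  without a distinguished origin; the class of the canonical representative is taken as 0.\<close>

definition coord :: "('a \<times> 'a) set \<Rightarrow> 'a \<Rightarrow> int" where
  "coord E x = class_count E (rep (steps E) x) x"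

lemma coord_cong:
  assumes E: "congruence E" and xy: "(x, y) \<in> E"
  shows "coord E x = coord E y"
proof -
  have "x \<in> X" "y \<in> X" "(x, y) \<in> steps E" using cong_sub[OF E xy] subset_steps[OF E] xy by auto
  then show ?thesis
    using rep_eq_iff[OF E] rep_eq_iff[OF congruence_steps[OF E]] xy
    unfolding coord_def class_count_def by metis
qed

lemma coord_less:
  assumes E: "congruence E" and xy: "(x, y) \<in> steps E" "(x, y) \<notin> E" "x < y"
  shows "coord E x < coord E y"
proof -
  have S: "congruence (steps E)" by (rule congruence_steps[OF E])
  have X: "x \<in> X" "y \<in> X" using xy by (auto simp: steps_def)
  have "rep (steps E) x = rep (steps E) y" using rep_eq_iff[OF S X] xy by blast
  moreover have "(rep (steps E) x, x) \<in> steps E" using cong_sym[OF S rep_rel[OF S X(1)]] .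
  ultimately show ?thesis
    using class_count_trans[OF E _ xy(1), of "rep (steps E) x"] class_count_pos[OF E xy]
    by (simp add: coord_def)
qed

text \<open>A point of least index in its \<open>F\<close>-class has least index in its smaller
  \<open>steps E\<close>-class too, and so lies in the class chosen as origin.\<close>

lemma coord_eq_0_least:
  assumes E: "congruence E" and F: "congruence F" and "steps E \<subseteq> F" and x: "x \<in> X" and "rep F x = x"
  shows "coord E x = 0"
proof -
  have "rep (steps E) x = x"
    using rep_least[OF F x] assms(3,5) by (intro rep_eqI[OF congruence_steps[OF E] x]) auto
  then show ?thesis using class_count_eq_0[OF E cong_refl[OF E x]] by (simp add: coord_def)
qed

section \<open>The well-ordered chain of congruences below a scattered one\<close>

definition below :: "('a \<times> 'a) set \<Rightarrow> ('a \<times> 'a) set set" where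
  "below N = {E. congruence E \<and> E \<subset> N}"

text \<open>The condition concerns only congruences strictly below \<open>N\<close>;
  \<open>steps N = N\<close> is allowed and is the case that leads to eta.\<close>

definition scattered :: "('a \<times> 'a) set \<Rightarrow> bool" where
  "scattered N \<longleftrightarrow> congruence N \<and> (\<forall>E\<in>below N. steps E \<noteq> E)"

lemma scatteredD:
  assumes "scattered N"
  shows scattered_congruence: "congruence N"
    and below_congruence: "E \<in> below N \<Longrightarrow> congruence E"
    and below_steps: "E \<in> below N \<Longrightarrow> steps E \<noteq> E"
    and below_steps_subset: "E \<in> below N \<Longrightarrow> steps E \<subseteq> N"
    and below_steps_subset_below: "E \<in> below N \<Longrightarrow> F \<in> below N \<Longrightarrow> E \<subset> F \<Longrightarrow> steps E \<subseteq> F"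
proof -
  show N: "congruence N" using assms by (simp add: scattered_def)
  show E: "congruence E" if "E \<in> below N" for E using that by (simp add: below_def)
  show ne: "steps E \<noteq> E" if "E \<in> below N" for E using assms that by (simp add: scattered_def)
  show "steps E \<subseteq> N" if "E \<in> below N"
    using steps_subset[OF E[OF that] N _ ne[OF that]] that by (simp add: below_def)
  show "steps E \<subseteq> F" if "E \<in> below N" "F \<in> below N" "E \<subset> F"
    using steps_subset[OF E E _ ne] that by blast
qed

lemma below_linear: "E \<in> below N \<Longrightarrow> F \<in> below N \<Longrightarrow> E \<subseteq> F \<or> F \<subseteq> E"
  using congruence_linear[of E F] by (auto simp: below_def)

text \<open>The index of the representative of the \<open>E\<close>-class of \<open>x\<close> decreases as \<open>E\<close> grows, strictly so
  past each \<open>E\<close> whose coordinate is nonzero.\<close>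

lemma finite_support:
  assumes N: "scattered N" and x: "x \<in> X"
  shows "finite {E \<in> below N. coord E x \<noteq> 0}"
proof -
  let ?S = "{E \<in> below N. coord E x \<noteq> 0}" and ?i = "\<lambda>E. to_nat_on X (rep E x)"
  have less: "?i F < ?i E" if "E \<in> ?S" "F \<in> ?S" "E \<subset> F" for E F
  proof -
    have cong: "congruence E" "congruence F" "congruence (steps E)"
      using that below_congruence[OF N] congruence_steps by blast+
    have sub: "E \<subseteq> steps E" "steps E \<subseteq> F"
      using subset_steps[OF cong(1)] below_steps_subset_below[OF N] that by blast+
    have r: "(x, rep E x) \<in> E" "(x, rep (steps E) x) \<in> steps E" using rep_rel cong x by blast+
    have "rep (steps E) x \<noteq> rep E x"
      using that(1) class_count_eq_0[OF cong(1)] cong_sym[OF cong(1) r(1)] unfolding coord_def by force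
    then have "?i (steps E) \<noteq> ?i E"
      using countable_X rep_in cong x by simp
    moreover have "?i (steps E) \<le> ?i E" using rep_least[OF cong(3) x] r(1) sub by blast
    moreover have "?i F \<le> ?i (steps E)" using rep_least[OF cong(2) x] r(2) sub by blast
    ultimately show ?thesis by simp
  qed
  have "inj_on ?i ?S"
  proof (rule inj_onI)
    fix E F assume EF: "E \<in> ?S" "F \<in> ?S" "?i E = ?i F"
    then have "E \<subseteq> F \<or> F \<subseteq> E" using below_linear by blast
    then show "E = F" using less[OF EF(1,2)] less[OF EF(2,1)] EF(3) by (metis less_irrefl psubsetI)
  qed
  moreover have "?i ` ?S \<subseteq> {..to_nat_on X x}"
    using rep_least cong_refl below_congruence[OF N] x by (auto simp: image_subset_iff)
  ultimately show ?thesis by (meson finite_atMost finite_imageD finite_subset)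
qed

text \<open>Choose for each \<open>E\<close> a pair in \<open>steps E - E\<close>. A larger
  congruence contains \<open>steps E\<close>, so different congruences receive different pairs of
  points of the countable set \<open>X\<close>.\<close>

lemma countable_below:
  assumes N: "scattered N"
  shows "countable (below N)"
proof -
  have "\<exists>p. p \<in> steps E - E" if "E \<in> below N" for E
    using subset_steps[of E] below_congruence[OF N that] below_steps[OF N that] by blast
  then obtain p where p: "\<And>E. E \<in> below N \<Longrightarrow> p E \<in> steps E - E" by metis
  have "inj_on p (below N)"
  proof (rule inj_onI)
    fix E F assume EF: "E \<in> below N" "F \<in> below N" "p E = p F"
    have "\<not> E \<subset> F" if "E \<in> below N" "F \<in> below N" "p E = p F" for E F
      using below_steps_subset_below[OF N that(1,2)] p[OF that(1)] p[OF that(2)] that(3) by auto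
    then show "E = F" using below_linear EF by (metis psubsetI)
  qed
  moreover have "p ` below N \<subseteq> X \<times> X" using p by (force simp: steps_def)
  ultimately show ?thesis
    using countable_X by (meson countable_SIGMA countable_image_inj_on countable_subset)
qed

text \<open>This is the well-foundedness of inclusion. If the intersection were not a member, its
  \<open>steps\<close> would be contained in every member and therefore in the intersection, which
  is then stationary.\<close>

lemma below_minimal:
  assumes N: "scattered N" and sub: "\<E> \<subseteq> below N" and ne: "\<E> \<noteq> {}"
  shows "\<Inter>\<E> \<in> \<E>"
proof (rule ccontr)
  assume notin: "\<Inter>\<E> \<notin> \<E>"
  have cong: "congruence (\<Inter>\<E>)" using sub below_congruence[OF N] ne by (intro congruence_Inter) auto
  then have "\<Inter>\<E> \<in> below N" using sub ne unfolding below_def by blast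
  then have "steps (\<Inter>\<E>) \<subseteq> E" if "E \<in> \<E>" for E
    using below_steps_subset_below[OF N, of "\<Inter>\<E>" E] sub notin that by blast
  then have "steps (\<Inter>\<E>) \<subseteq> \<Inter>\<E>" by blast
  then show False using subset_steps[OF cong] below_steps[OF N \<open>\<Inter>\<E> \<in> below N\<close>] by blast
qed

text \<open>The deciding level is the largest congruence that separates \<open>x\<close> from
  \<open>y\<close>. Larger ones relate the two points and give equal coordinates; at this level
  \<open>steps\<close> relates them, so the coordinates are comparable and distinct.\<close>

lemma first_difference:
  assumes N: "scattered N" and xy: "(x, y) \<in> N" "x < y"
  obtains E where "E \<in> below N" "coord E x < coord E y"
    "\<And>F. F \<in> below N \<Longrightarrow> coord F x \<noteq> coord F y \<Longrightarrow> F \<subseteq> E"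
proof -
  define \<E> where "\<E> = {E. congruence E \<and> (x, y) \<notin> E}"
  have X: "x \<in> X" "y \<in> X" using cong_sub[OF scattered_congruence[OF N] xy(1)] by auto
  have "Id_on X \<in> \<E>" using xy(2) congruence_Id by (auto simp: \<E>_def)
  then have cong: "congruence (\<Union>\<E>)" by (intro congruence_Union) (auto simp: \<E>_def)
  have notin: "(x, y) \<notin> \<Union>\<E>" by (auto simp: \<E>_def)
  then have below: "\<Union>\<E> \<in> below N"
    using congruence_linear[OF cong scattered_congruence[OF N]] cong xy(1) by (auto simp: below_def)
  have "(x, y) \<in> steps (\<Union>\<E>)"
  proof (rule ccontr)
    assume "(x, y) \<notin> steps (\<Union>\<E>)"
    then have "steps (\<Union>\<E>) \<subseteq> \<Union>\<E>" using congruence_steps[OF cong] by (auto simp: \<E>_def)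
    then show False using subset_steps[OF cong] below_steps[OF N below] by blast
  qed
  then have "coord (\<Union>\<E>) x < coord (\<Union>\<E>) y" using coord_less[OF cong _ notin xy(2)] by blast
  moreover have "F \<subseteq> \<Union>\<E>" if "F \<in> below N" "coord F x \<noteq> coord F y" for F
    using coord_cong that below_congruence[OF N that(1)] by (auto simp: \<E>_def)
  ultimately show thesis using that below by blast
qed

text \<open>Coordinates are prescribed from the largest congruence of the support downwards, hence
  the induction removes the smallest, \<open>E\<close>. Moving inside a \<open>steps E\<close>-class
  adjusts the coordinate at \<open>E\<close> and leaves those of larger congruences alone.\<close>

lemma coord_surj:
  assumes N: "scattered N" and "finite S"
  shows "S \<subseteq> below N \<Longrightarrow> (\<And>E. E \<notin> S \<Longrightarrow> f E = 0) \<Longrightarrow> x \<in> X \<Longrightarrow>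
    \<exists>y. (x, y) \<in> N \<and> (\<forall>E\<in>below N. coord E y = f E)"
  using assms(2)
proof (induction S arbitrary: f rule: finite_psubset_induct)
  case (psubset S)
  have Nc: "congruence N" by (rule scattered_congruence[OF N])
  show ?case
  proof (cases "S = {}")
    case True
    \<comment> \<open>The canonical representative of the whole \<open>N\<close>-class is the origin
      at every level.\<close>
    have "coord E (rep N x) = 0" if "E \<in> below N" for E
      using coord_eq_0_least[OF below_congruence[OF N that] Nc below_steps_subset[OF N that]]
        rep_in[OF Nc] rep_idem[OF Nc] psubset.prems by blast
    then show ?thesis using rep_rel[OF Nc] psubset.prems True by auto
  next
    case False
    define E where "E = \<Inter>S"
    have E: "E \<in> S" "E \<in> below N"
      using below_minimal[OF N psubset.prems(1) False] psubset.prems(1) by (auto simp: E_def)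
    have cong: "congruence E" "congruence (steps E)"
      using below_congruence[OF N E(2)] congruence_steps by auto
    have "\<exists>y. (x, y) \<in> N \<and> (\<forall>F\<in>below N. coord F y = (f(E := 0)) F)"
    proof (rule psubset.IH)
      show "S - {E} \<subset> S" using E(1) by blast
      show "S - {E} \<subseteq> below N" "x \<in> X" using psubset.prems by blast+
      show "(f(E := 0)) F = 0" if "F \<notin> S - {E}" for F using that psubset.prems(2) by auto
    qed
    then obtain y where y: "(x, y) \<in> N" "\<And>F. F \<in> below N \<Longrightarrow> coord F y = (f(E := 0)) F" by blast
    have yX: "y \<in> X" using cong_sub[OF Nc y(1)] by blast
    define b where "b = rep (steps E) y"
    have b: "(y, b) \<in> steps E" "b \<in> X"
      using rep_rel[OF cong(2) yX] rep_in[OF cong(2) yX] by (auto simp: b_def)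
    obtain z where z: "(b, z) \<in> steps E" "class_count E b z = f E"
      using class_count_surj[OF cong(1) below_steps[OF N E(2)] b(2)] by blast
    \<comment> \<open>Passing to the representative of the \<open>E\<close>-class of
      \<open>z\<close> keeps the coordinate at \<open>E\<close> and sets all coordinates of smaller
      congruences to 0.\<close>
    define u where "u = rep E z"
    have zX: "z \<in> X" using z(1) by (simp add: steps_def)
    have zu: "(z, u) \<in> E" "u \<in> X" "rep E u = u"
      using rep_rel[OF cong(1) zX] rep_in[OF cong(1) zX] rep_idem[OF cong(1) zX] by (auto simp: u_def)
    have yu: "(y, u) \<in> steps E"
      using b(1) z(1) zu(1) subset_steps[OF cong(1)] cong_trans[OF cong(2)] by blast
    have "coord F u = f F" if F: "F \<in> below N" for F
    proof -
      have Fc: "congruence F" by (rule below_congruence[OF N F])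
      consider "F = E" | "E \<subset> F" | "F \<subset> E" using below_linear[OF E(2) F] by blast
      then show ?thesis
      proof cases
        case 1
        have "rep (steps E) u = b" using rep_eq_iff[OF cong(2) yX zu(2)] yu by (simp add: b_def)
        moreover have "class_count E b u = class_count E b z"
          using rep_eq_iff[OF cong(1) zX zu(2)] zu(1) by (simp add: class_count_def)
        ultimately show ?thesis using z(2) 1 by (simp add: coord_def)
      next
        case 2
        then have "(u, y) \<in> F"
          using below_steps_subset_below[OF N E(2) F] yu cong_sym[OF Fc] by blast
        then show ?thesis using coord_cong[OF Fc] y(2)[OF F] 2 by auto
      next
        case 3
        then have "F \<notin> S" by (auto simp: E_def)
        moreover have "coord F u = 0"
          using coord_eq_0_least[OF Fc cong(1) below_steps_subset_below[OF N F E(2) 3]] zu by blast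
        ultimately show ?thesis using psubset.prems(2) by simp
      qed
    qed
    moreover have "(x, u) \<in> N"
      using y(1) yu below_steps_subset[OF N E(2)] cong_trans[OF Nc] by blast
    ultimately show ?thesis by blast
  qed
qed

text \<open>The ordinal is the inclusion order of \<open>below N\<close>, numbered so as to live on
  the naturals. \<open>\<Phi>\<close> is defined on all of \<open>X\<close> but is an isomorphism
  only on each single \<open>N\<close>-class; its injectivity there follows from strict
  monotonicity.\<close>

theorem zeta_power_coordinates:
  assumes N: "scattered N"
  obtains w :: "nat rel" and \<Phi> where "Well_order w"
    "\<And>x. x \<in> X \<Longrightarrow> \<Phi> x \<in> fin_supp_funs w"
    "\<And>x y. (x, y) \<in> N \<Longrightarrow> x < y \<Longrightarrow> (\<Phi> x, \<Phi> y) \<in> zeta_power w \<and> \<Phi> x \<noteq> \<Phi> y"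
    "\<And>f x. f \<in> fin_supp_funs w \<Longrightarrow> x \<in> X \<Longrightarrow> \<exists>y. (x, y) \<in> N \<and> \<Phi> y = f"
proof -
  define \<iota> where "\<iota> = to_nat_on (below N)"
  have inj: "inj_on \<iota> (below N)" using inj_on_to_nat_on[OF countable_below[OF N]] by (simp add: \<iota>_def)
  define w where "w = {(\<iota> E, \<iota> F) | E F. E \<in> below N \<and> F \<in> below N \<and> E \<subseteq> F}"
  have w_iff: "(\<iota> E, \<iota> F) \<in> w \<longleftrightarrow> E \<subseteq> F" if "E \<in> below N" "F \<in> below N" for E F
    using that inj unfolding w_def by (auto dest: inj_onD)
  have w_cases: "\<exists>E F. a = \<iota> E \<and> b = \<iota> F \<and> E \<in> below N \<and> F \<in> below N \<and> E \<subseteq> F" if "(a, b) \<in> w" for a b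
    using that by (auto simp: w_def)
  have field: "Field w = \<iota> ` below N" by (auto simp: w_def Field_def)
  have "Linear_order w"
    unfolding linear_order_on_def partial_order_on_def preorder_on_def
  proof (intro conjI)
    show "w \<subseteq> Field w \<times> Field w" by (auto simp: Field_def)
    show "refl_on (Field w) w" by (rule refl_onI) (auto simp: field w_iff)
    show "trans w"
    proof (rule transI)
      fix a b c assume ab: "(a, b) \<in> w" and bc: "(b, c) \<in> w"
      obtain E F where EF: "a = \<iota> E" "b = \<iota> F" "E \<in> below N" "F \<in> below N" "E \<subseteq> F"
        using w_cases[OF ab] by blast
      obtain H where H: "c = \<iota> H" "H \<in> below N" using w_cases[OF bc] by blast
      then have "F \<subseteq> H" using bc EF w_iff by blast
      then show "(a, c) \<in> w" using EF H w_iff by blast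
    qed
    show "antisym w"
    proof (rule antisymI)
      fix a b assume ab: "(a, b) \<in> w" and ba: "(b, a) \<in> w"
      obtain E F where EF: "a = \<iota> E" "b = \<iota> F" "E \<in> below N" "F \<in> below N" "E \<subseteq> F"
        using w_cases[OF ab] by blast
      then have "F \<subseteq> E" using ba w_iff by blast
      then show "a = b" using EF by simp
    qed
    show "total_on (Field w) w"
    proof (rule total_onI)
      fix a b assume "a \<in> Field w" "b \<in> Field w"
      then obtain E F where "a = \<iota> E" "b = \<iota> F" "E \<in> below N" "F \<in> below N" by (auto simp: field)
      then show "(a, b) \<in> w \<or> (b, a) \<in> w"
        using below_linear[of E N F] w_iff[of E F] w_iff[of F E] by simp
    qed
  qed
  moreover have "wf (w - Id)"
    unfolding wf_eq_minimal
  proof (intro allI impI)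
    fix Q and n :: nat assume n: "n \<in> Q"
    show "\<exists>z\<in>Q. \<forall>y. (y, z) \<in> w - Id \<longrightarrow> y \<notin> Q"
    proof (cases "Q \<inter> Field w = {}")
      case True
      then show ?thesis using n by (intro bexI[of _ n]) (auto dest: FieldI1)
    next
      case False
      define \<E> where "\<E> = {E \<in> below N. \<iota> E \<in> Q}"
      have sub: "\<E> \<subseteq> below N" by (auto simp: \<E>_def)
      have "\<Inter>\<E> \<in> \<E>" using False by (intro below_minimal[OF N sub]) (auto simp: \<E>_def field)
      moreover have "y \<notin> Q" if y: "(y, \<iota> (\<Inter>\<E>)) \<in> w - Id" for y
      proof
        assume "y \<in> Q"
        obtain E where E: "E \<in> below N" "y = \<iota> E" using y w_cases by blast
        have "\<Inter>\<E> \<in> below N" using sub \<open>\<Inter>\<E> \<in> \<E>\<close> by (rule subsetD)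
        then have "E \<subseteq> \<Inter>\<E>" using y w_iff[OF E(1), of "\<Inter>\<E>"] E(2) by simp
        moreover have "E \<in> \<E>" using E \<open>y \<in> Q\<close> by (simp add: \<E>_def)
        ultimately have "\<Inter>\<E> = E" by blast
        then show False using y E(2) by simp
      qed
      moreover have "\<iota> E \<in> Q" if "E \<in> \<E>" for E using that by (simp add: \<E>_def)
      ultimately show ?thesis by blast
    qed
  qed
  ultimately have wo: "Well_order w" by (simp add: well_order_on_def)
  \<comment> \<open>The value 0 at numbers outside the field of \<open>w\<close> is the encoding
    required by \<open>fin_supp_funs\<close>.\<close>
  define \<Phi> where "\<Phi> x n = (if n \<in> \<iota> ` below N then coord (inv_into (below N) \<iota> n) x else 0)" for x n
  have \<Phi>: "\<Phi> x (\<iota> E) = coord E x" if "E \<in> below N" for x E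
    using that inj by (simp add: \<Phi>_def)
  have ran: "\<Phi> x \<in> fin_supp_funs w" if x: "x \<in> X" for x
  proof -
    have "{n. \<Phi> x n \<noteq> 0} \<subseteq> \<iota> ` {E \<in> below N. coord E x \<noteq> 0}"
    proof
      fix n assume n: "n \<in> {n. \<Phi> x n \<noteq> 0}"
      then obtain E where "E \<in> below N" "n = \<iota> E" by (auto simp: \<Phi>_def split: if_splits)
      then show "n \<in> \<iota> ` {E \<in> below N. coord E x \<noteq> 0}" using n \<Phi> by auto
    qed
    then have "finite {n. \<Phi> x n \<noteq> 0}" "{n. \<Phi> x n \<noteq> 0} \<subseteq> Field w"
      using finite_support[OF N x] by (auto simp: field intro: finite_subset)
    then show ?thesis by (simp add: fin_supp_funs_def)
  qed
  have less: "(\<Phi> x, \<Phi> y) \<in> zeta_power w \<and> \<Phi> x \<noteq> \<Phi> y" if xy: "(x, y) \<in> N" "x < y" for x y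
  proof -
    have X: "x \<in> X" "y \<in> X" using cong_sub[OF scattered_congruence[OF N] xy(1)] by auto
    obtain E where E: "E \<in> below N" "coord E x < coord E y"
      "\<And>F. F \<in> below N \<Longrightarrow> coord F x \<noteq> coord F y \<Longrightarrow> F \<subseteq> E"
      using first_difference[OF N xy] by metis
    have ne: "\<Phi> x (\<iota> E) < \<Phi> y (\<iota> E)" using E \<Phi> by simp
    have "\<forall>m\<in>Field w. \<Phi> x m \<noteq> \<Phi> y m \<longrightarrow> (m, \<iota> E) \<in> w" using E(1,3) \<Phi> w_iff by (simp add: field)
    then have "\<exists>n\<in>Field w. \<Phi> x n \<noteq> \<Phi> y n \<and> (\<forall>m\<in>Field w. \<Phi> x m \<noteq> \<Phi> y m \<longrightarrow> (m, n) \<in> w) \<and> \<Phi> x n < \<Phi> y n"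
      using E(1) ne by (intro bexI[of _ "\<iota> E"]) (auto simp: field)
    then show ?thesis using ran X ne by (auto simp: zeta_power_def)
  qed
  have surj: "\<exists>y. (x, y) \<in> N \<and> \<Phi> y = f" if f: "f \<in> fin_supp_funs w" and x: "x \<in> X" for f x
  proof -
    define S where "S = {E \<in> below N. f (\<iota> E) \<noteq> 0}"
    have "finite (\<iota> ` S)"
      by (rule finite_subset[of _ "{n. f n \<noteq> 0}"]) (use f in \<open>auto simp: S_def fin_supp_funs_def\<close>)
    moreover have "inj_on \<iota> S" by (rule inj_on_subset[OF inj]) (auto simp: S_def)
    ultimately have "finite S" using finite_imageD by blast
    then have "\<exists>y. (x, y) \<in> N \<and> (\<forall>E\<in>below N. coord E y = (if E \<in> below N then f (\<iota> E) else 0))"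
      by (rule coord_surj[OF N]) (use x in \<open>auto simp: S_def\<close>)
    then obtain y where y: "(x, y) \<in> N" "\<And>E. E \<in> below N \<Longrightarrow> coord E y = f (\<iota> E)" by auto
    have "\<Phi> y n = f n" for n
    proof (cases "n \<in> \<iota> ` below N")
      case True
      then show ?thesis using \<Phi> y(2) by auto
    next
      case False
      then show ?thesis using f by (auto simp: \<Phi>_def fin_supp_funs_def field)
    qed
    then show ?thesis using y(1) by auto
  qed
  show thesis using that[OF wo ran less surj] by blast
qed

end

subsection \<open>Colexicographic products\<close>

lemma zeta_power_refl: "refl_on (fin_supp_funs w) (zeta_power w)"
  by (rule refl_onI) (simp add: zeta_power_def)

lemma Field_zeta_power: "Field (zeta_power w) = fin_supp_funs w"
proof
  show "Field (zeta_power w) \<subseteq> fin_supp_funs w" by (auto simp: Field_def zeta_power_def)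
  show "fin_supp_funs w \<subseteq> Field (zeta_power w)"
    using zeta_power_refl by (blast intro: FieldI1 dest: refl_onD)
qed

lemma zeta_power_antisym:
  assumes "antisym w"
  shows "antisym (zeta_power w)"
proof (rule antisymI, rule ccontr)
  fix f g assume fg: "(f, g) \<in> zeta_power w" "(g, f) \<in> zeta_power w" "f \<noteq> g"
  obtain x where x: "x \<in> Field w" "f x \<noteq> g x" "\<And>y. y \<in> Field w \<Longrightarrow> f y \<noteq> g y \<Longrightarrow> (y, x) \<in> w" "f x < g x"
    using fg(1,3) unfolding zeta_power_def by blast
  obtain y where y: "y \<in> Field w" "g y \<noteq> f y" "\<And>x. x \<in> Field w \<Longrightarrow> g x \<noteq> f x \<Longrightarrow> (x, y) \<in> w" "g y < f y"
    using fg(2,3) unfolding zeta_power_def by blast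
  have "(y, x) \<in> w" "(x, y) \<in> w" using x(1-3) y(1-3) by metis+
  then have "x = y" using assms antisymD by metis
  then show False using x(4) y(4) by simp
qed

lemma Field_colex_prod:
  assumes "refl_on (Field r) r" "refl_on (Field s) s"
  shows "Field (colex_prod r s) = Field r \<times> Field s"
proof
  show "Field (colex_prod r s) \<subseteq> Field r \<times> Field s" by (auto simp: Field_def colex_prod_def)
  show "Field r \<times> Field s \<subseteq> Field (colex_prod r s)"
  proof clarify
    fix a b assume "a \<in> Field r" "b \<in> Field s"
    then have "((a, b), (a, b)) \<in> colex_prod r s"
      using assms by (simp add: colex_prod_def refl_onD)
    then show "(a, b) \<in> Field (colex_prod r s)" by (rule FieldI1)
  qed
qed

lemma colex_prod_refl:
  assumes "refl_on (Field r) r" "refl_on (Field s) s"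
  shows "refl_on (Field (colex_prod r s)) (colex_prod r s)"
proof (rule refl_onI)
  fix p assume "p \<in> Field (colex_prod r s)"
  then have "fst p \<in> Field r" "snd p \<in> Field s"
    unfolding Field_colex_prod[OF assms] by (simp_all add: mem_Times_iff)
  then show "(p, p) \<in> colex_prod r s"
    using assms by (cases p) (simp add: colex_prod_def refl_onD)
qed

lemma colex_prod_antisym:
  assumes "antisym r" "antisym s"
  shows "antisym (colex_prod r s)"
proof (rule antisymI)
  fix p q assume "(p, q) \<in> colex_prod r s" "(q, p) \<in> colex_prod r s"
  then show "p = q"
    using antisymD[OF assms(1), of "fst p" "fst q"] antisymD[OF assms(2), of "snd p" "snd q"]
    by (cases p; cases q) (auto simp: colex_prod_def)
qed

context transitive_chain
begin

text \<open>\<open>Y\<close> is a union of \<open>N\<close>-classes and each class is a full copy of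
  the zeta power, so the coordinates inside a class together with the label of the class fill the
  whole product. Points of different classes are ordered by their labels, which is the
  colexicographic rule.\<close>

lemma colex_coordinates:
  assumes N: "scattered N" and Y: "Y \<subseteq> X" "\<And>x y. x \<in> Y \<Longrightarrow> (x, y) \<in> N \<Longrightarrow> y \<in> Y"
    and S: "refl_on (Field S) S"
    and k: "bij_betw k (rep N ` Y) (Field S)"
    and k_less: "\<And>q q'. q \<in> rep N ` Y \<Longrightarrow> q' \<in> rep N ` Y \<Longrightarrow> q < q' \<Longrightarrow> (k q, k q') \<in> S"
  obtains w :: "nat rel" and f where "Well_order w"
    "bij_betw f Y (Field (colex_prod (zeta_power w) S))"
    "\<And>x y. x \<in> Y \<Longrightarrow> y \<in> Y \<Longrightarrow> x < y \<Longrightarrow> (f x, f y) \<in> colex_prod (zeta_power w) S"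
proof -
  have Nc: "congruence N" by (rule scattered_congruence[OF N])
  obtain w :: "nat rel" and \<Phi> where w: "Well_order w"
    and ran: "\<And>x. x \<in> X \<Longrightarrow> \<Phi> x \<in> fin_supp_funs w"
    and less: "\<And>x y. (x, y) \<in> N \<Longrightarrow> x < y \<Longrightarrow> (\<Phi> x, \<Phi> y) \<in> zeta_power w \<and> \<Phi> x \<noteq> \<Phi> y"
    and surj: "\<And>f x. f \<in> fin_supp_funs w \<Longrightarrow> x \<in> X \<Longrightarrow> \<exists>y. (x, y) \<in> N \<and> \<Phi> y = f"
    using zeta_power_coordinates[OF N] by metis
  define f where "f x = (\<Phi> x, k (rep N x))" for x
  have field: "Field (colex_prod (zeta_power w) S) = fin_supp_funs w \<times> Field S"
    using Field_colex_prod[of "zeta_power w" S] zeta_power_refl[of w] S by (simp add: Field_zeta_power)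
  have k_in: "k (rep N x) \<in> Field S" if "x \<in> Y" for x
    using k that by (auto simp: bij_betw_def)
  have f_less: "(f x, f y) \<in> colex_prod (zeta_power w) S \<and> f x \<noteq> f y"
    if x: "x \<in> Y" and y: "y \<in> Y" and "x < y" for x y
  proof (cases "(x, y) \<in> N")
    case True
    then have "rep N x = rep N y" using rep_eq_iff[OF Nc] x y Y(1) by blast
    then show ?thesis
      using less[OF True \<open>x < y\<close>] k_in[OF y] ran x y Y(1)
      by (auto simp: f_def colex_prod_def Field_zeta_power)
  next
    case False
    then have "rep N x < rep N y" using rep_less[OF Nc] x y Y(1) \<open>x < y\<close> by blast
    moreover have "k (rep N x) \<noteq> k (rep N y)"
      using inj_on_eq_iff[OF bij_betw_imp_inj_on[OF k] imageI[OF x] imageI[OF y]] calculation by simp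
    ultimately show ?thesis
      using k_less k_in[OF x] k_in[OF y] ran x y Y(1)
      by (auto simp: f_def colex_prod_def Field_zeta_power)
  qed
  have "inj_on f Y"
    by (rule linorder_inj_onI') (use f_less in blast)
  moreover have "f ` Y \<subseteq> fin_supp_funs w \<times> Field S"
    using ran k_in Y(1) by (auto simp: f_def)
  moreover have "fin_supp_funs w \<times> Field S \<subseteq> f ` Y"
  proof clarify
    fix g s assume g: "g \<in> fin_supp_funs w" and "s \<in> Field S"
    then have "s \<in> k ` rep N ` Y" using bij_betw_imp_surj_on[OF k] by simp
    then obtain x where x: "x \<in> Y" "k (rep N x) = s" by blast
    then obtain y where y: "(x, y) \<in> N" "\<Phi> y = g" using surj[OF g] Y(1) by blast
    then have "rep N x = rep N y" using rep_eq_iff[OF Nc] cong_sub[OF Nc] by blast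
    then show "(g, s) \<in> f ` Y" using x y Y(2) by (intro image_eqI[of _ _ y]) (auto simp: f_def)
  qed
  ultimately have "bij_betw f Y (Field (colex_prod (zeta_power w) S))"
    by (simp add: bij_betw_def field subset_antisym)
  then show thesis using that w f_less by blast
qed

text \<open>The union of all scattered congruences separating the two points is again one. If its
  \<open>steps\<close> were different and still separated them, \<open>steps\<close> would be a
  larger member of the family, because no congruence lies strictly in between.\<close>

lemma maximal_scattered:
  assumes p: "p \<in> X" "p' \<in> X" "p \<noteq> p'"
  obtains N where "scattered N" "(p, p') \<notin> N" "steps N = N \<or> (p, p') \<in> steps N"
proof -
  define \<E> where "\<E> = {E. scattered E \<and> (p, p') \<notin> E}"
  define N where "N = \<Union>\<E>"
  \<comment> \<open>Equality is vacuously scattered, so the family is not empty.\<close>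
  have "below (Id_on X) = {}" using cong_refl by (auto simp: below_def)
  then have "Id_on X \<in> \<E>" using congruence_Id p by (auto simp: \<E>_def scattered_def)
  then have Nc: "congruence N"
    unfolding N_def by (intro congruence_Union) (auto simp: \<E>_def scattered_def)
  have N_below: "steps E \<noteq> E" if E: "E \<in> below N" for E
  proof -
    have Ec: "congruence E" using E by (simp add: below_def)
    \<comment> \<open>A congruence strictly below the union fails to contain some member
      \<open>M\<close>, and by comparability lies strictly below it.\<close>
    obtain M where M: "M \<in> \<E>" "\<not> M \<subseteq> E" using E unfolding below_def N_def by blast
    then have "scattered M" by (simp add: \<E>_def)
    moreover have "E \<in> below M"
      using congruence_linear[OF Ec scattered_congruence[OF \<open>scattered M\<close>]] Ec M(2)
      by (auto simp: below_def)
    ultimately show ?thesis by (rule below_steps)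
  qed
  then have N: "scattered N" using Nc by (simp add: scattered_def)
  have "(p, p') \<in> steps N" if ne: "steps N \<noteq> N"
  proof (rule ccontr)
    assume notin: "(p, p') \<notin> steps N"
    have sc: "congruence (steps N)" by (rule congruence_steps[OF Nc])
    have "steps E \<noteq> E" if "E \<in> below (steps N)" for E
    proof -
      have E: "congruence E" "E \<subset> steps N" using that by (auto simp: below_def)
      consider "E \<subset> N" | "E = N" | "N \<subset> E" using congruence_linear[OF E(1) Nc] by blast
      then show ?thesis
      proof cases
        case 1
        then show ?thesis using N_below E(1) by (simp add: below_def)
      next
        case 2
        then show ?thesis using ne by simp
      next
        \<comment> \<open>Impossible, since \<open>steps N\<close> is the immediate successor of
          \<open>N\<close>.\<close>
        case 3
        then show ?thesis using steps_subset[OF Nc E(1) _ ne] E(2) by blast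
      qed
    qed
    then have "steps N \<in> \<E>" using notin sc by (simp add: \<E>_def scattered_def)
    then have "steps N \<subseteq> N" by (auto simp: N_def)
    then show False using subset_steps[OF Nc] ne by blast
  qed
  moreover have "(p, p') \<notin> N" by (auto simp: N_def \<E>_def)
  ultimately show thesis using that N by blast
qed

text \<open>With no class strictly between them, the interval from \<open>x\<close> to
  \<open>y\<close> would meet just two classes, and \<open>steps N\<close> would relate
  \<open>x\<close> to \<open>y\<close>.\<close>

lemma steps_eq_between:
  assumes N: "congruence N" and eq: "steps N = N" and x: "x \<in> X" and y: "y \<in> X"
    and less: "x < y" "(x, y) \<notin> N"
  obtains z where "z \<in> X" "x < z" "z < y" "(x, z) \<notin> N" "(z, y) \<notin> N"
proof (rule ccontr)
  assume no: "\<not> thesis"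
  have r: "rep N x < rep N y" by (rule rep_less[OF N x y less])
  have "rep N ` X \<inter> {rep N x..rep N y} \<subseteq> {rep N x, rep N y}"
  proof (rule subsetI, rule ccontr)
    fix q assume q: "q \<in> rep N ` X \<inter> {rep N x..rep N y}" "q \<notin> {rep N x, rep N y}"
    then obtain z where z: "z \<in> X" "q = rep N z" by blast
    then have "rep N x < rep N z" "rep N z < rep N y" using q by auto
    then show False using no that rep_less_iff[OF N] x y z(1) by blast
  qed
  then have "finite (rep N ` X \<inter> {rep N x..rep N y})" by (rule finite_subset) simp
  then have "(x, y) \<in> steps N" using r x y by (simp add: steps_def)
  then show False using eq less by simp
qed

end

subsection \<open>Periodic chains of reals\<close>

locale periodic_set =
  fixes X :: "real set"
  assumes periodic: "x + 1 \<in> X \<longleftrightarrow> x \<in> X"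
begin

definition automorphisms :: "(real \<Rightarrow> real) set" where
  "automorphisms = {g. bij_betw g X X \<and> strict_mono_on X g \<and> (\<forall>z\<in>X. g (z + 1) = g z + 1)}"

lemma inverse_automorphism:
  assumes g: "g \<in> automorphisms"
  shows "inv_into X g \<in> automorphisms"
proof -
  have bij: "bij_betw g X X" and mono: "strict_mono_on X g"
    and shift: "\<And>z. z \<in> X \<Longrightarrow> g (z + 1) = g z + 1"
    using g by (auto simp: automorphisms_def)
  let ?h = "inv_into X g"
  have h: "?h y \<in> X" "g (?h y) = y" if "y \<in> X" for y
    using bij that by (auto simp: bij_betw_def inv_into_into f_inv_into_f)
  have "strict_mono_on X ?h"
  proof (rule strict_mono_onI, rule ccontr)
    fix x y assume xy: "x \<in> X" "y \<in> X" "x < y" "\<not> ?h x < ?h y"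
    then have "?h y \<le> ?h x" by simp
    then have "g (?h y) \<le> g (?h x)"
      using strict_mono_onD[OF mono h(1)[OF xy(2)] h(1)[OF xy(1)]] by (auto simp: le_less)
    then show False using h xy by simp
  qed
  moreover have "?h (y + 1) = ?h y + 1" if y: "y \<in> X" for y
  proof -
    have "?h (g (?h y + 1)) = ?h y + 1"
      by (rule inv_into_f_f) (use bij_betw_imp_inj_on[OF bij] h(1)[OF y] periodic in simp_all)
    then show ?thesis using shift h[OF y] by simp
  qed
  ultimately show ?thesis using bij_betw_inv_into[OF bij] by (simp add: automorphisms_def)
qed

lemma periodic_int: "x + of_int k \<in> X \<longleftrightarrow> x \<in> X"
proof (induction k rule: int_induct[of _ 0])
  case (step1 i)
  then show ?case using periodic[of "x + of_int i"] by (simp add: add.assoc)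
next
  case (step2 i)
  then show ?case using periodic[of "x + of_int (i - 1)"] by (simp add: algebra_simps)
qed simp

lemma translation_automorphism: "(\<lambda>x. x + of_int k) \<in> automorphisms"
proof -
  have "bij_betw (\<lambda>x. x + of_int k) X X"
  proof (rule bij_betw_byWitness[of _ "\<lambda>x. x + of_int (- k)"])
    show "(\<lambda>x. x + of_int k) ` X \<subseteq> X" "(\<lambda>x. x + of_int (- k)) ` X \<subseteq> X"
      unfolding image_subset_iff periodic_int by blast+
  qed simp_all
  then show ?thesis by (auto simp: automorphisms_def strict_mono_on_def)
qed

lemma compose_automorphisms:
  assumes g: "g \<in> automorphisms" and h: "h \<in> automorphisms"
  shows "h \<circ> g \<in> automorphisms"
proof -
  have maps: "g x \<in> X" if "x \<in> X" for x using g that by (auto simp: automorphisms_def bij_betw_def)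
  have "bij_betw (h \<circ> g) X X" using g h by (auto simp: automorphisms_def intro: bij_betw_trans)
  moreover have "strict_mono_on X (h \<circ> g)"
    using g h maps by (auto simp: automorphisms_def strict_mono_on_def)
  moreover have "(h \<circ> g) (z + 1) = (h \<circ> g) z + 1" if "z \<in> X" for z
    using g h maps that by (simp add: automorphisms_def)
  ultimately show ?thesis by (simp add: automorphisms_def)
qed

end

locale periodic_chain = periodic_set +
  assumes countable: "countable X"
    and transitive_automorphisms: "x \<in> X \<Longrightarrow> y \<in> X \<Longrightarrow> \<exists>g\<in>automorphisms. g x = y"
begin

sublocale transitive_chain X automorphisms
proof
  show "countable X" by (rule countable)
  show "g x \<in> X" if "g \<in> automorphisms" "x \<in> X" for g x using that by (auto simp: automorphisms_def bij_betw_def)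
  show "g x < g y" if "g \<in> automorphisms" "x \<in> X" "y \<in> X" "x < y" for g x y
    using that by (auto simp: automorphisms_def dest: strict_mono_onD)
  show "\<exists>h\<in>automorphisms. \<forall>x\<in>X. h (g x) = x \<and> g (h x) = x" if g: "g \<in> automorphisms" for g
  proof (intro bexI ballI)
    show "inv_into X g \<in> automorphisms" by (rule inverse_automorphism[OF g])
    show "inv_into X g (g x) = x \<and> g (inv_into X g x) = x" if "x \<in> X" for x
      using g that by (auto simp: automorphisms_def bij_betw_def f_inv_into_f)
  qed
  show "\<exists>g\<in>automorphisms. g x = y" if "x \<in> X" "y \<in> X" for x y by (rule transitive_automorphisms[OF that])
qed

section \<open>Congruences and the unit translation\<close>

lemma congruence_translate_iff:
  assumes "congruence N" "x \<in> X" "y \<in> X"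
  shows "(x + of_int k, y + of_int k) \<in> N \<longleftrightarrow> (x, y) \<in> N"
  using congruence_invariant_iff[OF assms(1) translation_automorphism assms(2,3), of k] by simp

text \<open>Automorphisms commute with the translation and act transitively, so whether a congruence
  joins a point to its translate does not depend on the point.\<close>

lemma congruence_shift_iff:
  assumes N: "congruence N" and X: "x \<in> X" "y \<in> X"
  shows "(x, x + 1) \<in> N \<longleftrightarrow> (y, y + 1) \<in> N"
proof -
  obtain g where g: "g \<in> automorphisms" "g x = y" using transitive X by metis
  then have "g (x + 1) = y + 1" using X by (auto simp: automorphisms_def)
  then show ?thesis using congruence_invariant_iff[OF N g(1) X(1), of "x + 1"] periodic X g(2) by metis
qed

section \<open>Cuts along classes\<close>

definition cut :: "(real \<times> real) set \<Rightarrow> real set \<Rightarrow> bool" where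
  "cut N I \<longleftrightarrow> I \<subseteq> X \<and> I \<noteq> {} \<and> I \<noteq> X \<and>
     (\<forall>x\<in>I. \<forall>y\<in>X. y \<le> x \<or> (x, y) \<in> N \<longrightarrow> y \<in> I)"

text \<open>A gap of the quotient: there is no last class before the cut and no first class after
  it.\<close>

definition open_cut :: "(real \<times> real) set \<Rightarrow> real set \<Rightarrow> bool" where
  "open_cut N I \<longleftrightarrow> (\<forall>x\<in>I. \<exists>y\<in>I. x < y \<and> (x, y) \<notin> N) \<and>
     (\<forall>x\<in>X - I. \<exists>y\<in>X - I. y < x \<and> (y, x) \<notin> N)"

definition normalized :: "real set \<Rightarrow> bool" where
  "normalized I \<longleftrightarrow> X \<inter> {..<0} \<subseteq> I \<and> I \<subseteq> {..<1}"

lemma normalize_cut: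
  assumes N: "congruence N" and I: "cut N I"
  obtains J where "cut N J" "normalized J" "open_cut N I \<Longrightarrow> open_cut N J"
proof -
  have IX: "I \<subseteq> X" "I \<noteq> {}" "I \<noteq> X"
    and down: "\<And>x y. x \<in> I \<Longrightarrow> y \<in> X \<Longrightarrow> y \<le> x \<Longrightarrow> y \<in> I"
    and sat: "\<And>x y. x \<in> I \<Longrightarrow> y \<in> X \<Longrightarrow> (x, y) \<in> N \<Longrightarrow> y \<in> I"
    using I unfolding cut_def by blast+
  obtain b where b: "b \<in> X" "b \<notin> I" using IX by blast
  have bdd: "bdd_above I"
    by (rule bdd_aboveI[of _ b]) (use down b in \<open>meson linear\<close>)
  \<comment> \<open>Translating by \<open>- k\<close> brings the supremum of the cut into
    \<open>[0, 1)\<close>, which is exactly what normalization needs.\<close>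
  define k where "k = \<lfloor>Sup I\<rfloor>"
  define J where "J = {x \<in> X. x + of_int k \<in> I}"
  have XJ: "x \<in> X - J \<longleftrightarrow> x + of_int k \<in> X - I" for x
    using periodic_int[of x k] by (auto simp: J_def)
  have xJ: "x \<in> J \<longleftrightarrow> x + of_int k \<in> I" for x
    using periodic_int[of x k] IX(1) by (auto simp: J_def)
  have tr: "(x + of_int k, y + of_int k) \<in> N \<longleftrightarrow> (x, y) \<in> N" if "x \<in> X" "y \<in> X" for x y
    by (rule congruence_translate_iff[OF N that])
  have JX: "J \<subseteq> X" by (auto simp: J_def)
  have "cut N J"
    unfolding cut_def
  proof (intro conjI ballI impI)
    show "J \<subseteq> X" by (rule JX)
    obtain a where "a \<in> I" using IX(2) by blast
    then show "J \<noteq> {}" using xJ[of "a - of_int k"] by auto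
    show "J \<noteq> X" using b XJ[of "b - of_int k"] by auto
    show "y \<in> J" if "x \<in> J" "y \<in> X" "y \<le> x \<or> (x, y) \<in> N" for x y
      using down[of "x + of_int k" "y + of_int k"] sat[of "x + of_int k" "y + of_int k"]
        tr[of x y] that xJ JX periodic_int[of y k] by auto
  qed
  moreover have "normalized J"
    unfolding normalized_def
  proof (intro conjI subsetI)
    fix x assume "x \<in> X \<inter> {..<0}"
    then have x: "x \<in> X" "x + of_int k < Sup I" unfolding k_def by (auto intro: less_le_trans[OF _ of_int_floor_le])
    then obtain y where "y \<in> I" "x + of_int k < y" using less_cSup_iff[OF IX(2) bdd] by blast
    then show "x \<in> J" using down periodic_int[of x k] x(1) xJ by (meson less_imp_le)
  next
    fix x assume "x \<in> J"
    then have "x + of_int k \<le> Sup I" using bdd xJ by (simp add: cSup_upper)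
    then show "x \<in> {..<1}" unfolding k_def by simp linarith
  qed
  moreover have "open_cut N J" if o: "open_cut N I"
    unfolding open_cut_def
  proof (intro conjI ballI)
    fix x assume x: "x \<in> J"
    then obtain y where y: "y \<in> I" "x + of_int k < y" "(x + of_int k, y) \<notin> N"
      using o xJ unfolding open_cut_def by blast
    define z where "z = y - of_int k"
    then have "y = z + of_int k" by simp
    then show "\<exists>y\<in>J. x < y \<and> (x, y) \<notin> N" using x y xJ tr[of x z] JX by (intro bexI[of _ z]) auto
  next
    fix x assume x: "x \<in> X - J"
    then obtain y where y: "y \<in> X - I" "y < x + of_int k" "(y, x + of_int k) \<notin> N"
      using o XJ unfolding open_cut_def by blast
    define z where "z = y - of_int k"
    then have "y = z + of_int k" by simp
    then show "\<exists>y\<in>X - J. y < x \<and> (y, x) \<notin> N" using x y XJ[of z] tr[of z x] by (intro bexI[of _ z]) auto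
  qed
  ultimately show thesis using that by blast
qed

text \<open>The period that begins at the cut: a fundamental domain for the unit
  translation.\<close>

definition domain_of :: "real set \<Rightarrow> real set" where
  "domain_of I = {x \<in> X. x \<notin> I \<and> x - 1 \<in> I}"

lemma minus_one: "x - 1 \<in> X \<longleftrightarrow> x \<in> X"
  using periodic[of "x - 1"] by simp

lemma domain_of_saturated:
  assumes N: "congruence N" and I: "cut N I" and x: "x \<in> domain_of I" and xy: "(x, y) \<in> N"
  shows "y \<in> domain_of I"
proof -
  have X: "x \<in> X" "y \<in> X" using cong_sub[OF N xy] by auto
  have "(x - 1, y - 1) \<in> N" using congruence_translate_iff[OF N X, of "-1"] xy by simp
  then have "y - 1 \<in> I" using x I minus_one X unfolding cut_def domain_of_def by blast
  moreover have "y \<notin> I" using x I X cong_sym[OF N xy] unfolding cut_def domain_of_def by blast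
  ultimately show ?thesis using X by (simp add: domain_of_def)
qed

lemma domain_of_nonempty:
  assumes "normalized I" "X \<noteq> {}"
  shows "domain_of I \<noteq> {}"
proof -
  obtain p where p: "p \<in> X" using assms(2) by blast
  \<comment> \<open>The translate of \<open>p\<close> in \<open>[0, 1)\<close> is in the domain if
    it lies after the cut; otherwise its own translate by 1 is.\<close>
  define x where "x = p + of_int (- \<lfloor>p\<rfloor>)"
  have x: "x \<in> X" unfolding x_def periodic_int by (rule p)
  have x01: "0 \<le> x" "x < 1" unfolding x_def by simp_all linarith
  show ?thesis
  proof (cases "x \<in> I")
    case True
    then have "x + 1 \<in> domain_of I"
      using assms(1) x x01 periodic by (auto simp: domain_of_def normalized_def)
    then show ?thesis by blast
  next
    case False
    then have "x \<in> domain_of I"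
      using assms(1) x x01 minus_one by (auto simp: domain_of_def normalized_def)
    then show ?thesis by blast
  qed
qed

text \<open>With \<open>x\<close> before the cut and \<open>x + 1\<close> after it, the domain lies
  between \<open>x\<close> and \<open>x + 2\<close>, and \<open>steps N\<close> relates these two
  points through \<open>x + 1\<close>.\<close>

lemma finite_rep_domain_of:
  assumes N: "congruence N" and I: "cut N I" and steps: "p \<in> X" "(p, p + 1) \<in> steps N"
  shows "finite (rep N ` domain_of I)"
proof (cases "domain_of I = {}")
  case False
  have S: "congruence (steps N)" by (rule congruence_steps[OF N])
  obtain x where x: "x \<in> X" "x \<in> I" "x + 1 \<notin> I"
    using False periodic unfolding domain_of_def by (force simp: minus_one)
  have "(x, x + 1) \<in> steps N" "(x + 1, x + 1 + 1) \<in> steps N"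
    using congruence_shift_iff[OF S steps(1)] steps(2) x(1) periodic by blast+
  then have "(x, x + 1 + 1) \<in> steps N" by (rule cong_trans[OF S])
  then have fin: "finite (rep N ` X \<inter> {rep N x..rep N (x + 1 + 1)})" by (simp add: steps_def)
  have "rep N ` domain_of I \<subseteq> rep N ` X \<inter> {rep N x..rep N (x + 1 + 1)}"
  proof (rule image_subsetI)
    fix z assume z: "z \<in> domain_of I"
    then have zX: "z \<in> X" "z \<notin> I" "z - 1 \<in> I" by (auto simp: domain_of_def)
    have "x \<le> z" using zX x(2) I unfolding cut_def by (meson linear)
    moreover have "z - 1 \<le> x + 1" using zX x I periodic unfolding cut_def by (meson linear)
    then have "z \<le> x + 1 + 1" by simp
    moreover have "x + 1 + 1 \<in> X" unfolding periodic by (rule x(1))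
    ultimately show "rep N z \<in> rep N ` X \<inter> {rep N x..rep N (x + 1 + 1)}"
      using rep_le_iff[OF N x(1) zX(1)] rep_le_iff[OF N zX(1), of "x + 1 + 1"] zX(1) by simp
  qed
  then show ?thesis using fin finite_subset by blast
qed simp

text \<open>No first class, because none comes first after the gap. No last class, because none
  comes last before the gap and the end of the domain is that side moved by one period. Density is
  \<open>steps N = N\<close>.\<close>

lemma dense_rep_domain_of:
  assumes N: "congruence N" and eq: "steps N = N" and I: "cut N I" "open_cut N I"
    and ne: "domain_of I \<noteq> {}"
  shows "dense_unbounded (rep N ` domain_of I)"
  unfolding dense_unbounded_def
proof (intro conjI ballI impI)
  have down: "\<And>x y. x \<in> I \<Longrightarrow> y \<in> X \<Longrightarrow> y \<le> x \<Longrightarrow> y \<in> I" and IX: "I \<subseteq> X"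
    using I(1) unfolding cut_def by blast+
  have dom: "\<exists>x. q = rep N x \<and> x \<in> X \<and> x \<notin> I \<and> x - 1 \<in> I" if "q \<in> rep N ` domain_of I" for q
    using that by (auto simp: domain_of_def)
  show "rep N ` domain_of I \<noteq> {}" using ne by simp
  {
    fix q assume "q \<in> rep N ` domain_of I"
    then obtain x where x: "q = rep N x" "x \<in> X" "x \<notin> I" "x - 1 \<in> I" using dom by blast
    obtain y where y: "y \<in> X" "y \<notin> I" "y < x" "(y, x) \<notin> N"
      using I(2) x unfolding open_cut_def by blast
    have "y - 1 \<in> I" using down[OF x(4)] y minus_one by simp
    then have "y \<in> domain_of I" using y by (simp add: domain_of_def)
    moreover have "rep N y < q" using rep_less[OF N] x y by simp
    ultimately show "\<exists>y\<in>rep N ` domain_of I. y < q" by blast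
  next
    fix q assume "q \<in> rep N ` domain_of I"
    then obtain x where x: "q = rep N x" "x \<in> X" "x \<notin> I" "x - 1 \<in> I" using dom by blast
    obtain y where y: "y \<in> I" "x - 1 < y" "(x - 1, y) \<notin> N"
      using I(2) x unfolding open_cut_def by blast
    have yX: "y \<in> X" "y + 1 \<in> X" using y IX periodic by auto
    have "y + 1 \<notin> I" using down[of "y + 1" x] x y by auto
    then have "y + 1 \<in> domain_of I" using y yX by (simp add: domain_of_def)
    moreover have "(x, y + 1) \<notin> N"
      using congruence_translate_iff[OF N _ yX(1), of "x - 1" 1] x(2) y(3) minus_one by simp
    then have "q < rep N (y + 1)" using rep_less[OF N x(2) yX(2)] x y by simp
    ultimately show "\<exists>y\<in>rep N ` domain_of I. q < y" by blast
  next
    fix q r assume "q \<in> rep N ` domain_of I" "r \<in> rep N ` domain_of I" "q < r"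
    then obtain x y where x: "q = rep N x" "x \<in> X" "x \<notin> I" and y: "r = rep N y" "y \<in> X" "y - 1 \<in> I"
      using dom by blast
    have "x < y" "(x, y) \<notin> N" using \<open>q < r\<close> rep_less_iff[OF N x(2) y(2)] x y by auto
    then obtain z where z: "z \<in> X" "x < z" "z < y" "(x, z) \<notin> N" "(z, y) \<notin> N"
      using steps_eq_between[OF N eq x(2) y(2)] by blast
    have "z \<notin> I" using down[of z x] z x by auto
    moreover have "z - 1 \<in> I" using down[OF y(3)] z minus_one by simp
    ultimately have "z \<in> domain_of I" using z by (simp add: domain_of_def)
    moreover have "q < rep N z" "rep N z < r" using rep_less[OF N] x y z by simp_all
    ultimately show "\<exists>z\<in>rep N ` domain_of I. q < z \<and> z < r" by blast
  }
qed

text \<open>The set of classes is countable, dense and without endpoints, hence isomorphic to the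
  rationals and equally to the rationals without 0. In the latter model the missing 0 is a gap,
  which is pulled back.\<close>

lemma ex_open_cut:
  assumes N: "congruence N" and eq: "steps N = N" and p: "p \<in> X" "(p, p + 1) \<notin> N"
  shows "\<exists>I. cut N I \<and> open_cut N I"
proof -
  let ?Q = "rep N ` X" and ?R = "UNIV - {0 :: rat}"
  have up: "rep N x < rep N (x + 1)" if "x \<in> X" for x
    using rep_less[OF N] congruence_shift_iff[OF N that p(1)] p(2) that periodic by simp
  have "dense_unbounded ?Q"
    unfolding dense_unbounded_def
  proof (intro conjI ballI impI)
    show "?Q \<noteq> {}" using p by blast
    show "\<exists>y\<in>?Q. q < y" if "q \<in> ?Q" for q using that up periodic by blast
    show "\<exists>y\<in>?Q. y < q" if q: "q \<in> ?Q" for q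
    proof -
      obtain x where "q = rep N x" "x \<in> X" using q by blast
      then show ?thesis using up[of "x - 1"] minus_one by (intro bexI[of _ "rep N (x - 1)"]) auto
    qed
    show "\<exists>z\<in>?Q. q < z \<and> z < r" if qr: "q \<in> ?Q" "r \<in> ?Q" "q < r" for q r
    proof -
      obtain x y where x: "q = rep N x" "x \<in> X" and y: "r = rep N y" "y \<in> X" using qr by blast
      have "x < y" "(x, y) \<notin> N" using qr(3) rep_less_iff[OF N x(2) y(2)] x y by auto
      then obtain z where "z \<in> X" "x < z" "z < y" "(x, z) \<notin> N" "(z, y) \<notin> N"
        using steps_eq_between[OF N eq x(2) y(2)] by blast
      then show ?thesis using rep_less[OF N] x y by (intro bexI[of _ "rep N z"]) auto
    qed
  qed
  moreover have "dense_unbounded ?R"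
    unfolding dense_unbounded_def
  proof (intro conjI ballI impI)
    show "?R \<noteq> {}" by (metis DiffI UNIV_I empty_iff singletonD zero_neq_one)
    show "\<exists>y\<in>?R. y < x" if "x \<in> ?R" for x by (rule bexI[of _ "min x 0 - 1"]) auto
    show "\<exists>y\<in>?R. x < y" if "x \<in> ?R" for x by (rule bexI[of _ "max x 0 + 1"]) auto
    show "\<exists>z\<in>?R. x < z \<and> z < y" if "x \<in> ?R" "y \<in> ?R" "x < y" for x y
    \<comment> \<open>The midpoint serves unless it is the missing 0; in that case \<open>y\<close>
      is positive and \<open>y / 2\<close> serves.\<close>
    proof (cases "x + y = 0")
      case True
      then show ?thesis using that by (intro bexI[of _ "y / 2"]) auto
    next
      case False
      then show ?thesis using that by (intro bexI[of _ "(x + y) / 2"]) (auto simp: field_simps)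
    qed
  qed
  moreover have "countable ?Q" "countable ?R" using countable_X by auto
  ultimately obtain h where h: "bij_betw h ?Q ?R" "strict_mono_on ?Q h"
    using countable_dense_unbounded_iso[of ?Q ?R] by metis
  have onto: "\<exists>x\<in>X. h (rep N x) = c" if "c \<noteq> 0" for c
  proof -
    have "c \<in> h ` ?Q" using bij_betw_imp_surj_on[OF h(1)] that by simp
    then show ?thesis by blast
  qed
  have nz: "h (rep N x) \<noteq> 0" if "x \<in> X" for x using h(1) that by (auto simp: bij_betw_def)
  have less_iff: "h (rep N x) < h (rep N y) \<longleftrightarrow> rep N x < rep N y" if "x \<in> X" "y \<in> X" for x y
    using strict_mono_on_less[OF h(2)] that by blast
  have step: "x < y \<and> (x, y) \<notin> N" if "x \<in> X" "y \<in> X" "h (rep N x) < h (rep N y)" for x y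
    using that less_iff rep_less_iff[OF N] by blast
  define I where "I = {x \<in> X. h (rep N x) < 0}"
  have "cut N I"
    unfolding cut_def
  proof (intro conjI ballI impI)
    show "I \<subseteq> X" by (auto simp: I_def)
    show "I \<noteq> {}" using onto[of "-1"] by (force simp: I_def)
    show "I \<noteq> X" using onto[of 1] by (force simp: I_def)
    fix x y assume xy: "x \<in> I" "y \<in> X" "y \<le> x \<or> (x, y) \<in> N"
    then have "rep N y \<le> rep N x" using rep_le_iff[OF N] cong_sym[OF N] by (auto simp: I_def)
    then have "\<not> h (rep N x) < h (rep N y)" using less_iff xy by (auto simp: I_def)
    then show "y \<in> I" using xy by (auto simp: I_def)
  qed
  moreover have "open_cut N I"
    unfolding open_cut_def
  proof (intro conjI ballI)
    \<comment> \<open>Halving a nonzero value moves it towards the gap without reaching it.\<close>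
    fix x assume x: "x \<in> I"
    then obtain y where "y \<in> X" "h (rep N y) = h (rep N x) / 2"
      using onto[of "h (rep N x) / 2"] by (auto simp: I_def)
    then show "\<exists>y\<in>I. x < y \<and> (x, y) \<notin> N" using x step[of x y] by (intro bexI[of _ y]) (auto simp: I_def)
  next
    fix x assume x: "x \<in> X - I"
    then have pos: "0 < h (rep N x)" using nz[of x] by (auto simp: I_def)
    then obtain y where "y \<in> X" "h (rep N y) = h (rep N x) / 2"
      using onto[of "h (rep N x) / 2"] by auto
    then show "\<exists>y\<in>X - I. y < x \<and> (y, x) \<notin> N" using x pos step[of y x] by (intro bexI[of _ y]) (auto simp: I_def)
  qed
  ultimately show ?thesis by blast
qed

theorem domain_classification:
  assumes p: "p \<in> X"
  obtains N I and w :: "nat rel" where "cut N I" "normalized I" "Well_order w"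
    "(\<exists>n f. bij_betw f (domain_of I) (Field (colex_prod (zeta_power w) (natLeq_on n))) \<and>
        (\<forall>x\<in>domain_of I. \<forall>y\<in>domain_of I. x < y \<longrightarrow> (f x, f y) \<in> colex_prod (zeta_power w) (natLeq_on n))) \<or>
     (\<exists>f. bij_betw f (domain_of I) (Field (colex_prod (zeta_power w) eta_order)) \<and>
        (\<forall>x\<in>domain_of I. \<forall>y\<in>domain_of I. x < y \<longrightarrow> (f x, f y) \<in> colex_prod (zeta_power w) eta_order))"
proof -
  obtain N where N: "scattered N" "(p, p + 1) \<notin> N" "steps N = N \<or> (p, p + 1) \<in> steps N"
    using maximal_scattered[of p "p + 1"] p periodic by auto
  have Nc: "congruence N" by (rule scattered_congruence[OF N(1)])
  have sub: "domain_of I \<subseteq> X" for I by (auto simp: domain_of_def)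
  show thesis
  proof (cases "steps N = N")
    case True
    obtain I where I: "cut N I" "open_cut N I" "normalized I"
      using ex_open_cut[OF Nc True p N(2)] normalize_cut[OF Nc] by metis
    let ?Q = "rep N ` domain_of I"
    have "dense_unbounded ?Q"
      using dense_rep_domain_of[OF Nc True I(1,2)] domain_of_nonempty[OF I(3)] p by blast
    moreover have "dense_unbounded (UNIV :: rat set)"
      using dense by (auto simp: dense_unbounded_def intro: lt_ex gt_ex)
    moreover have "countable ?Q" using countable_subset[OF sub countable_X] by simp
    ultimately obtain k where k: "bij_betw k ?Q (UNIV :: rat set)" "strict_mono_on ?Q k"
      using countable_dense_unbounded_iso[of ?Q "UNIV :: rat set"] by auto
    have field: "Field eta_order = UNIV" by (auto simp: eta_order_def Field_def)
    obtain w :: "nat rel" and f where "Well_order w"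
      "bij_betw f (domain_of I) (Field (colex_prod (zeta_power w) eta_order))"
      "\<And>x y. x \<in> domain_of I \<Longrightarrow> y \<in> domain_of I \<Longrightarrow> x < y \<Longrightarrow> (f x, f y) \<in> colex_prod (zeta_power w) eta_order"
    proof (rule colex_coordinates[OF N(1) sub domain_of_saturated[OF Nc I(1)]])
      show "refl_on (Field eta_order) eta_order" by (rule refl_onI) (simp add: eta_order_def)
      show "bij_betw k ?Q (Field eta_order)" using k(1) field by simp
      show "(k q, k r) \<in> eta_order" if "q \<in> ?Q" "r \<in> ?Q" "q < r" for q r
        using strict_mono_onD[OF k(2) that] by (simp add: eta_order_def)
    qed blast+
    then show thesis using that I by blast
  next
    case False
    then have steps: "(p, p + 1) \<in> steps N" using N(3) by blast
    \<comment> \<open>Here any cut along classes will do. The one just after the class of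
      \<open>p\<close> is proper because \<open>p + 1\<close> lies in a later class.\<close>
    have "cut N {x \<in> X. rep N x \<le> rep N p}"
      unfolding cut_def
    proof (intro conjI ballI impI)
      show "{x \<in> X. rep N x \<le> rep N p} \<noteq> {}" using p by blast
      have "p + 1 \<in> X" "\<not> rep N (p + 1) \<le> rep N p"
        using rep_less[OF Nc p, of "p + 1"] p periodic N(2) by auto
      then show "{x \<in> X. rep N x \<le> rep N p} \<noteq> X" by blast
      fix x y assume xy: "x \<in> {x \<in> X. rep N x \<le> rep N p}" "y \<in> X" "y \<le> x \<or> (x, y) \<in> N"
      then have "rep N y \<le> rep N x" using rep_le_iff[OF Nc] cong_sym[OF Nc] by blast
      then show "y \<in> {x \<in> X. rep N x \<le> rep N p}" using xy by auto
    qed blast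
    then obtain I where I: "cut N I" "normalized I" using normalize_cut[OF Nc] by metis
    let ?Q = "rep N ` domain_of I"
    have fin: "finite ?Q" by (rule finite_rep_domain_of[OF Nc I(1) p steps])
    \<comment> \<open>Each of the finitely many classes is labelled by its rank, starting at
      0.\<close>
    define k where "k q = card {r \<in> ?Q. r < q}" for q
    define n where "n = card ?Q"
    have k_less: "k q < k r" if "q \<in> ?Q" "r \<in> ?Q" "q < r" for q r
      unfolding k_def using that fin by (intro psubset_card_mono) auto
    have k_n: "k q < n" if "q \<in> ?Q" for q
      unfolding k_def n_def using that fin by (intro psubset_card_mono) auto
    have inj: "inj_on k ?Q"
      by (rule linorder_inj_onI') (use k_less in \<open>metis less_irrefl\<close>)
    have sub_n: "k ` ?Q \<subseteq> {..<n}" using k_n by auto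
    have "card (k ` ?Q) = card {..<n}" using card_image[OF inj] by (simp add: n_def)
    then have "k ` ?Q = {..<n}" using card_subset_eq[OF _ sub_n] by simp
    then have bij: "bij_betw k ?Q {x. x < n}" using inj by (simp add: bij_betw_def lessThan_def)
    obtain w :: "nat rel" and f where "Well_order w"
      "bij_betw f (domain_of I) (Field (colex_prod (zeta_power w) (natLeq_on n)))"
      "\<And>x y. x \<in> domain_of I \<Longrightarrow> y \<in> domain_of I \<Longrightarrow> x < y \<Longrightarrow> (f x, f y) \<in> colex_prod (zeta_power w) (natLeq_on n)"
    proof (rule colex_coordinates[OF N(1) sub domain_of_saturated[OF Nc I(1)]])
      show "refl_on (Field (natLeq_on n)) (natLeq_on n)"
        by (rule refl_onI) (simp add: Field_natLeq_on)
      show "bij_betw k ?Q (Field (natLeq_on n))" using bij by (simp add: Field_natLeq_on)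
      show "(k q, k r) \<in> natLeq_on n" if "q \<in> ?Q" "r \<in> ?Q" "q < r" for q r
        using k_less[OF that] k_n that by simp
    qed blast+
    then show thesis using that I by blast
  qed
qed

end

subsection \<open>The periodic cover of a linear order\<close>

text \<open>Each point is sent to the total weight of the points strictly below it. Passing from
  \<open>a\<close> to a larger \<open>b\<close> gains at least the weight of \<open>a\<close>
  itself.\<close>

lemma embed_in_unit_interval:
  fixes L :: "'a rel"
  assumes L: "Linear_order L" and cnt: "countable (Field L)"
  obtains f :: "'a \<Rightarrow> real" where "\<And>a. 0 \<le> f a \<and> f a < 1"
    "\<And>a b. (a, b) \<in> L \<Longrightarrow> a \<noteq> b \<Longrightarrow> f a < f b"
proof -
  define \<nu> where "\<nu> = to_nat_on (Field L)"
  have inj: "inj_on \<nu> (Field L)" using inj_on_to_nat_on[OF cnt] by (simp add: \<nu>_def)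
  have anti: "antisym L" and trans: "trans L"
    using L by (auto simp: linear_order_on_def partial_order_on_def preorder_on_def)
  define D where "D a = \<nu> ` {b. (b, a) \<in> L \<and> b \<noteq> a}" for a
  \<comment> \<open>The exponent \<open>n + 2\<close> makes the total weight 1/2, which keeps all
    values below 1.\<close>
  define t :: "'a \<Rightarrow> nat \<Rightarrow> real" where "t a n = (if n \<in> D a then (1 / 2) ^ (n + 2) else 0)" for a n
  have geo: "(\<lambda>n. (1 / 2 :: real) ^ (n + 2)) sums (1 / 2)"
    using sums_mult[OF geometric_sums[of "1 / 2 :: real"], of "1 / 4"] by (simp add: field_simps power_add)
  have t: "0 \<le> t a n" "t a n \<le> (1 / 2) ^ (n + 2)" for a n by (auto simp: t_def)
  have summ: "summable (t a)" for a
    using t by (intro summable_comparison_test'[OF sums_summable[OF geo]]) auto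
  define f where "f a = suminf (t a)" for a
  have f: "0 \<le> f a \<and> f a < 1" for a
  proof -
    have "f a \<le> 1 / 2"
      unfolding f_def using suminf_le[OF _ summ sums_summable[OF geo]] t sums_unique[OF geo] by metis
    moreover have "0 \<le> f a" unfolding f_def by (rule suminf_nonneg[OF summ t(1)])
    ultimately show ?thesis by simp
  qed
  have less: "f a < f b" if ab: "(a, b) \<in> L" "a \<noteq> b" for a b
  proof -
    have sub: "D a \<subseteq> D b"
      unfolding D_def
    proof (rule image_mono, rule subsetI)
      fix c assume "c \<in> {c. (c, a) \<in> L \<and> c \<noteq> a}"
      then have "(c, a) \<in> L" "c \<noteq> a" by auto
      then show "c \<in> {c. (c, b) \<in> L \<and> c \<noteq> b}"
        using ab transD[OF trans] antisymD[OF anti] by blast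
    qed
    have "\<nu> a \<in> D b" using ab by (auto simp: D_def)
    moreover have "\<nu> a \<notin> D a"
    proof
      assume "\<nu> a \<in> D a"
      then obtain c where c: "(c, a) \<in> L" "c \<noteq> a" "\<nu> a = \<nu> c" unfolding D_def by blast
      then have "a \<in> Field L" "c \<in> Field L" by (auto intro: FieldI1 FieldI2)
      then show False using c inj by (auto dest: inj_onD)
    qed
    ultimately have pos: "0 < t b (\<nu> a) - t a (\<nu> a)" by (simp add: t_def)
    have "0 < (\<Sum>n. t b n - t a n)"
      by (rule suminf_pos2[OF summable_diff[OF summ summ] _ pos]) (use sub in \<open>auto simp: t_def\<close>)
    then show ?thesis using suminf_diff[OF summ summ, of b a] by (simp add: f_def)
  qed
  show thesis using that f less by blast
qed

section \<open>The unrolled order and the lifting of cyclic maps\<close>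

lemma iso_Restr_iff:
  assumes "Refl r" "A \<subseteq> Field r" "Refl s" "B \<subseteq> Field s"
  shows "iso (Restr r A) (Restr s B) F \<longleftrightarrow>
    bij_betw F A B \<and> (\<forall>x\<in>A. \<forall>y\<in>A. (x, y) \<in> r \<longleftrightarrow> (F x, F y) \<in> s)"
proof -
  have "Field (Restr r A) = A" "Field (Restr s B) = B"
    using assms by (simp_all add: Refl_Field_Restr2)
  then show ?thesis unfolding iso_iff2 by (auto simp: bij_betw_def)
qed

lemma Linear_orderD:
  assumes "Linear_order r"
  shows "Refl r" "trans r" "antisym r"
    "x \<in> Field r \<Longrightarrow> y \<in> Field r \<Longrightarrow> (x, y) \<in> r \<or> (y, x) \<in> r"
proof -
  show "Refl r" "trans r" "antisym r"
    using assms by (auto simp: linear_order_on_def partial_order_on_def preorder_on_def)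
  show "(x, y) \<in> r \<or> (y, x) \<in> r" if "x \<in> Field r" "y \<in> Field r"
  proof (cases "x = y")
    case True
    then show ?thesis using \<open>Refl r\<close> that by (simp add: refl_onD)
  next
    case False
    then show ?thesis using assms that by (auto simp: linear_order_on_def total_on_def)
  qed
qed

lemma partition_less:
  assumes L: "Linear_order L" and "is_partition L A B" "x \<in> A" "y \<in> B"
  shows "(x, y) \<in> L \<and> x \<noteq> y"
proof -
  have A: "A \<subseteq> Field L" "\<And>a c. a \<in> A \<Longrightarrow> (c, a) \<in> L \<Longrightarrow> c \<in> A" and B: "B = Field L - A"
    using assms(2) by (auto simp: is_partition_def ofilter_def under_def)
  have "(y, x) \<notin> L" using A(2)[OF assms(3)] assms(4) B by blast
  then show ?thesis using Linear_orderD(4)[OF L, of x y] A(1) B assms(3,4) by auto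
qed

locale unit_embedding =
  fixes L :: "'a rel" and f :: "'a \<Rightarrow> real"
  assumes linear: "Linear_order L" and countable_Field: "countable (Field L)"
    and unit: "0 \<le> f a" "f a < 1"
    and f_mono: "(a, b) \<in> L \<Longrightarrow> a \<noteq> b \<Longrightarrow> f a < f b"
begin

text \<open>Z copies of \<open>L\<close> placed one after another: the floor of a point is the
  number of its copy, the fractional part is its place in \<open>L\<close>.\<close>

definition cover :: "real set" where
  "cover = {f a + of_int k | a k. a \<in> Field L}"

lemma coverI: "a \<in> Field L \<Longrightarrow> f a + of_int k \<in> cover"
  by (auto simp: cover_def)

lemma coverE:
  assumes "z \<in> cover"
  obtains a k where "a \<in> Field L" "z = f a + of_int k"
  using assms by (auto simp: cover_def)

lemma f_less_iff:
  assumes "a \<in> Field L" "b \<in> Field L"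
  shows "f a < f b \<longleftrightarrow> (a, b) \<in> L \<and> a \<noteq> b"
  using f_mono[of a b] f_mono[of b a] Linear_orderD(4)[OF linear assms]
  by (metis less_asym less_irrefl)

lemma f_le_iff:
  assumes "a \<in> Field L" "b \<in> Field L"
  shows "f a \<le> f b \<longleftrightarrow> (a, b) \<in> L"
  using f_less_iff[OF assms(2,1)] Linear_orderD(4)[OF linear assms]
    antisymD[OF Linear_orderD(3)[OF linear], of a b] by (metis linorder_not_le)

lemma inj_f: "inj_on f (Field L)"
  by (rule inj_onI) (metis antisymD[OF Linear_orderD(3)[OF linear]] f_le_iff order_refl)

lemma floor_f: "\<lfloor>f a + of_int k\<rfloor> = k"
  using unit[of a] by (simp add: floor_eq_iff)

lemma periodic_cover: "x + 1 \<in> cover \<longleftrightarrow> x \<in> cover"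
proof
  assume "x \<in> cover"
  then obtain a k where "a \<in> Field L" "x = f a + of_int k" by (rule coverE)
  then show "x + 1 \<in> cover" using coverI[of a "k + 1"] by (simp add: add.assoc)
next
  assume "x + 1 \<in> cover"
  then obtain a k where "a \<in> Field L" "x + 1 = f a + of_int k" by (rule coverE)
  then have "a \<in> Field L" "x = f a + of_int (k - 1)" by simp_all
  then show "x \<in> cover" using coverI by blast
qed

sublocale periodic_set cover
  by unfold_locales (rule periodic_cover)

text \<open>A cyclic automorphism lifts to the cover: it keeps the floor on \<open>A\<close>, which moves to the end
  of \<open>L\<close>, and raises it by one on \<open>B\<close>, which wraps around to the beginning.\<close>

lemma lift_automorphism:
  assumes ct: "cyclically_transitive L" and ab: "(a, b) \<in> L"
  obtains g where "g \<in> automorphisms" "g (f a) = f b"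
proof -
  obtain A B A' B' F H where P: "is_partition L A B" "is_partition L B' A'" "a \<in> A" "b \<in> A'"
    and FH: "iso (Restr L A) (Restr L A') F" "iso (Restr L B) (Restr L B') H" "F a = b"
    using ct[unfolded cyclically_transitive_def] ab by blast
  have AB: "A \<union> B = Field L" "A \<inter> B = {}" "A' \<union> B' = Field L" "A' \<inter> B' = {}"
    using P(1,2) by (auto simp: is_partition_def ofilter_def)
  have sub: "A \<subseteq> Field L" "B \<subseteq> Field L" "A' \<subseteq> Field L" "B' \<subseteq> Field L" using AB by blast+
  note refl = Linear_orderD(1)[OF linear]
  have F: "bij_betw F A A'" "\<And>x y. x \<in> A \<Longrightarrow> y \<in> A \<Longrightarrow> (x, y) \<in> L \<longleftrightarrow> (F x, F y) \<in> L"
    using FH(1) unfolding iso_Restr_iff[OF refl sub(1) refl sub(3)] by blast+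
  have H: "bij_betw H B B'" "\<And>x y. x \<in> B \<Longrightarrow> y \<in> B \<Longrightarrow> (x, y) \<in> L \<longleftrightarrow> (H x, H y) \<in> L"
    using FH(2) unfolding iso_Restr_iff[OF refl sub(2) refl sub(4)] by blast+
  define \<phi> where "\<phi> x = (if x \<in> A then F x else H x)" for x
  define c :: "'a \<Rightarrow> int" where "c x = (if x \<in> A then 0 else 1)" for x
  define g where "g z = (let x = inv_into (Field L) f (frac z) in f (\<phi> x) + of_int (\<lfloor>z\<rfloor> + c x))" for z
  have g: "g (f x + of_int k) = f (\<phi> x) + of_int (k + c x)" if "x \<in> Field L" for x k
  proof -
    have "frac (f x + of_int k) = f x" using floor_f[of x k] by (simp add: frac_def)
    then show ?thesis using that inj_f floor_f[of x k] by (simp add: g_def)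
  qed
  have \<phi>A: "\<phi> x \<in> A'" "c x = 0" if "x \<in> A" for x
    using that F(1) by (auto simp: \<phi>_def c_def bij_betw_def)
  have \<phi>B: "\<phi> x \<in> B'" "c x = 1" if "x \<in> B" for x
    using that H(1) AB(2) by (auto simp: \<phi>_def c_def bij_betw_def)
  have \<phi>_in: "\<phi> x \<in> Field L" if "x \<in> Field L" for x using \<phi>A \<phi>B AB that by blast
  have FA_less: "f (\<phi> x) < f (\<phi> y)" if "x \<in> A" "y \<in> A" "(x, y) \<in> L" "x \<noteq> y" for x y
  proof -
    have "(F x, F y) \<in> L" "F x \<noteq> F y"
      using F(2)[OF that(1,2)] that inj_on_eq_iff[OF bij_betw_imp_inj_on[OF F(1)] that(1,2)] by auto
    then show ?thesis using f_mono that by (simp add: \<phi>_def)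
  qed
  have HB_less: "f (\<phi> x) < f (\<phi> y)" if "x \<in> B" "y \<in> B" "(x, y) \<in> L" "x \<noteq> y" for x y
  proof -
    have "(H x, H y) \<in> L" "H x \<noteq> H y"
      using H(2)[OF that(1,2)] that inj_on_eq_iff[OF bij_betw_imp_inj_on[OF H(1)] that(1,2)] by auto
    moreover have "x \<notin> A" "y \<notin> A" using that AB(2) by blast+
    ultimately show ?thesis using f_mono by (simp add: \<phi>_def)
  qed
  have same: "f (\<phi> x) + of_int (k + c x) < f (\<phi> y) + of_int (k + c y)"
    if xy: "x \<in> Field L" "y \<in> Field L" "f x < f y" for x y k
  proof -
    have L: "(x, y) \<in> L" "x \<noteq> y" using f_less_iff xy by blast+
    consider "x \<in> A" "y \<in> A" | "x \<in> B" "y \<in> B" | "x \<in> A" "y \<in> B" | "x \<in> B" "y \<in> A"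
      using AB(1) xy by blast
    then show ?thesis
    proof cases
      case 1
      then show ?thesis using FA_less[OF 1 L] \<phi>A(2) by simp
    next
      case 2
      then show ?thesis using HB_less[OF 2 L] \<phi>B(2) by simp
    next
      case 3
      then show ?thesis using \<phi>A(2)[OF 3(1)] \<phi>B(2)[OF 3(2)] unit[of "\<phi> x"] unit[of "\<phi> y"] by simp
    next
      case 4
      then have "(y, x) \<in> L" using partition_less[OF linear P(1)] by blast
      then show ?thesis using L antisymD[OF Linear_orderD(3)[OF linear]] by blast
    qed
  qed
  have diff: "f (\<phi> x) + of_int (k + c x) < f (\<phi> y) + of_int (l + c y)"
    if xy: "x \<in> Field L" "y \<in> Field L" and "k < l" for x y k l
  proof -
    \<comment> \<open>In consecutive copies the images can fall into the same copy only if
      \<open>x\<close> is in \<open>B\<close> and \<open>y\<close> is in \<open>A\<close>; they then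
      lie in \<open>B'\<close> and \<open>A'\<close>, which are in the right order.\<close>
    have "f (\<phi> x) + of_int (c x) < f (\<phi> y) + of_int (c y) + 1"
    proof (cases "x \<in> B \<and> y \<in> A")
      case True
      then have "f (\<phi> x) < f (\<phi> y)"
        using partition_less[OF linear P(2)] \<phi>A \<phi>B f_mono by blast
      then show ?thesis using True \<phi>A(2) \<phi>B(2) by simp
    next
      case False
      then have "c x = 0 \<or> c y = 1" using AB(1) xy \<phi>A(2) \<phi>B(2) by blast
      moreover have "0 \<le> c y" "c x \<le> 1" by (auto simp: c_def)
      ultimately have "real_of_int (c x) \<le> of_int (c y)" by auto
      then show ?thesis using unit[of "\<phi> x"] unit[of "\<phi> y"] by linarith
    qed
    moreover have "real_of_int k + 1 \<le> of_int l" using \<open>k < l\<close> by linarith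
    ultimately show ?thesis by simp
  qed
  have mono: "strict_mono_on cover g"
  proof (rule strict_mono_onI)
    fix z z' assume z: "z \<in> cover" "z' \<in> cover" "z < z'"
    obtain x k where x: "x \<in> Field L" "z = f x + of_int k" using z(1) by (rule coverE)
    obtain y l where y: "y \<in> Field L" "z' = f y + of_int l" using z(2) by (rule coverE)
    have "k \<le> l" using z(3) floor_mono[of z z'] floor_f x y by simp
    then consider "k < l" | "k = l" "f x < f y" using z(3) x y by fastforce
    then show "g z < g z'"
      by cases (use same[OF x(1) y(1)] diff[OF x(1) y(1)] g x y in simp_all)
  qed
  have "g ` cover \<subseteq> cover"
    using g \<phi>_in coverI by (auto elim!: coverE simp del: of_int_add)
  moreover have "cover \<subseteq> g ` cover"
  proof
    fix z assume "z \<in> cover"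
    then obtain y k where y: "y \<in> Field L" "z = f y + of_int k" by (rule coverE)
    have "\<exists>x\<in>Field L. \<phi> x = y"
    proof (cases "y \<in> A'")
      case True
      then obtain x where "x \<in> A" "F x = y" using bij_betw_imp_surj_on[OF F(1)] by blast
      then show ?thesis using sub(1) by (auto simp: \<phi>_def)
    next
      case False
      then have "y \<in> B'" using AB(3) y(1) by blast
      then obtain x where "x \<in> B" "H x = y" using bij_betw_imp_surj_on[OF H(1)] by blast
      then show ?thesis using sub(2) AB(2) by (intro bexI[of _ x]) (auto simp: \<phi>_def)
    qed
    then obtain x where x: "x \<in> Field L" "\<phi> x = y" by blast
    then have "z = g (f x + of_int (k - c x))" using g[OF x(1), of "k - c x"] y by simp
    then show "z \<in> g ` cover" using coverI[OF x(1)] by blast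
  qed
  ultimately have "bij_betw g cover cover"
    using strict_mono_on_imp_inj_on[OF mono] by (simp add: bij_betw_def subset_antisym)
  moreover have "g (z + 1) = g z + 1" if z: "z \<in> cover" for z
  proof -
    obtain x k where x: "x \<in> Field L" "z = f x + of_int k" using z by (rule coverE)
    then show ?thesis using g[OF x(1), of k] g[OF x(1), of "k + 1"] by (simp add: add_ac)
  qed
  ultimately have "g \<in> automorphisms" using mono by (simp add: automorphisms_def)
  moreover have "g (f a) = f b"
    using g[of a 0] P(3) FH(3) sub(1) by (auto simp: \<phi>_def c_def)
  ultimately show thesis using that by blast
qed

end

subsection \<open>Fundamental domains and cyclic equivalence\<close>

text \<open>The fundamental domain is a set of reals, while the order to be produced lives on the
  naturals; it is carried over along an injective numbering.\<close>

definition order_copy :: "('b::linorder \<Rightarrow> 'c) \<Rightarrow> 'b set \<Rightarrow> 'c rel" where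
  "order_copy \<nu> Y = {(\<nu> x, \<nu> y) | x y. x \<in> Y \<and> y \<in> Y \<and> x \<le> y}"

lemma Field_order_copy: "Field (order_copy \<nu> Y) = \<nu> ` Y"
  by (force simp: order_copy_def Field_def)

lemma order_copy_iff:
  assumes "inj_on \<nu> Y" "x \<in> Y" "y \<in> Y"
  shows "(\<nu> x, \<nu> y) \<in> order_copy \<nu> Y \<longleftrightarrow> x \<le> y"
  using assms by (auto simp: order_copy_def dest: inj_onD)

lemma Linear_order_order_copy:
  assumes "inj_on \<nu> Y"
  shows "Linear_order (order_copy \<nu> Y)"
  unfolding linear_order_on_def partial_order_on_def preorder_on_def
proof (intro conjI)
  note iff = order_copy_iff[OF assms]
  show "order_copy \<nu> Y \<subseteq> Field (order_copy \<nu> Y) \<times> Field (order_copy \<nu> Y)" by (auto simp: Field_def)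
  show "refl_on (Field (order_copy \<nu> Y)) (order_copy \<nu> Y)"
    by (rule refl_onI) (auto simp: Field_order_copy iff)
  show "trans (order_copy \<nu> Y)"
  proof (rule transI)
    fix a b c assume ab: "(a, b) \<in> order_copy \<nu> Y" and bc: "(b, c) \<in> order_copy \<nu> Y"
    obtain x y where x: "a = \<nu> x" "b = \<nu> y" "x \<in> Y" "y \<in> Y" "x \<le> y"
      using ab unfolding order_copy_def by blast
    obtain z where z: "c = \<nu> z" "z \<in> Y" using bc unfolding order_copy_def by blast
    then have "y \<le> z" using bc iff x by blast
    then show "(a, c) \<in> order_copy \<nu> Y" using x z iff by simp
  qed
  show "antisym (order_copy \<nu> Y)"
  proof (rule antisymI)
    fix a b assume ab: "(a, b) \<in> order_copy \<nu> Y" and ba: "(b, a) \<in> order_copy \<nu> Y"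
    obtain x y where x: "a = \<nu> x" "b = \<nu> y" "x \<in> Y" "y \<in> Y" "x \<le> y"
      using ab unfolding order_copy_def by blast
    then show "a = b" using ba iff by simp
  qed
  show "total_on (Field (order_copy \<nu> Y)) (order_copy \<nu> Y)"
    by (rule total_onI) (auto simp: Field_order_copy iff)
qed

text \<open>The source is linear, so an increasing bijection onto an antisymmetric relation also
  reflects the order.\<close>

lemma same_order_type_order_copy:
  assumes inj: "inj_on \<nu> Y" and f: "bij_betw f Y (Field T)"
    and less: "\<And>x y. x \<in> Y \<Longrightarrow> y \<in> Y \<Longrightarrow> x < y \<Longrightarrow> (f x, f y) \<in> T"
    and T: "refl_on (Field T) T" "antisym T"
  shows "same_order_type (order_copy \<nu> Y) T"
proof -
  have iff: "(f x, f y) \<in> T \<longleftrightarrow> x \<le> y" if xy: "x \<in> Y" "y \<in> Y" for x y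
  proof
    assume "x \<le> y"
    then show "(f x, f y) \<in> T"
      using less[OF xy] T(1) bij_betwE[OF f] xy by (auto simp: le_less refl_onD)
  next
    assume fxy: "(f x, f y) \<in> T"
    show "x \<le> y"
    proof (rule ccontr)
      assume "\<not> x \<le> y"
      then have "y < x" by simp
      then have "f x = f y" using antisymD[OF T(2) fxy] less[OF xy(2,1)] by blast
      then show False
        using \<open>y < x\<close> inj_on_eq_iff[OF bij_betw_imp_inj_on[OF f] xy] by simp
    qed
  qed
  have "iso (order_copy \<nu> Y) T (f \<circ> inv_into Y \<nu>)"
    unfolding iso_iff2 Field_order_copy
  proof (intro conjI ballI)
    show "bij_betw (f \<circ> inv_into Y \<nu>) (\<nu> ` Y) (Field T)"
      using bij_betw_inv_into[OF inj_on_imp_bij_betw[OF inj]] f by (rule bij_betw_trans)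
    fix a b assume "a \<in> \<nu> ` Y" "b \<in> \<nu> ` Y"
    then obtain x y where "x \<in> Y" "y \<in> Y" "a = \<nu> x" "b = \<nu> y" by blast
    then show "(a, b) \<in> order_copy \<nu> Y \<longleftrightarrow> ((f \<circ> inv_into Y \<nu>) a, (f \<circ> inv_into Y \<nu>) b) \<in> T"
      using order_copy_iff[OF inj] iff inv_into_f_f[OF inj] by simp
  qed
  then show ?thesis by (auto simp: same_order_type_def)
qed

lemma zeta_colex_order:
  assumes "Well_order w" "refl_on (Field S) S" "antisym S"
  shows "refl_on (Field (colex_prod (zeta_power w) S)) (colex_prod (zeta_power w) S)"
    and "antisym (colex_prod (zeta_power w) S)"
proof -
  show "refl_on (Field (colex_prod (zeta_power w) S)) (colex_prod (zeta_power w) S)"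
    using zeta_power_refl[of w] assms(2) by (intro colex_prod_refl) (simp_all add: Field_zeta_power)
  have "antisym w" using assms(1) by (simp add: well_order_on_def Linear_orderD(3))
  then show "antisym (colex_prod (zeta_power w) S)"
    using assms(3) by (intro colex_prod_antisym zeta_power_antisym)
qed

section \<open>From the cover back to the linear order\<close>

context unit_embedding
begin

text \<open>Cyclic transitivity speaks only of moving a point upwards; moving it downwards uses the
  inverse of the lifted map.\<close>

lemma automorphism_of_points:
  assumes ct: "cyclically_transitive L" and ab: "a \<in> Field L" "b \<in> Field L"
  shows "\<exists>g\<in>automorphisms. g (f a) = f b"
proof (cases "(a, b) \<in> L")
  case True
  then show ?thesis using lift_automorphism[OF ct] by metis
next
  case False
  then have "(b, a) \<in> L" using Linear_orderD(4)[OF linear ab] by blast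
  then obtain g where g: "g \<in> automorphisms" "g (f b) = f a" using lift_automorphism[OF ct] by metis
  have "f b \<in> cover" using coverI[OF ab(2), of 0] by simp
  then have "inv_into cover g (f a) = f b"
    using g by (metis (no_types, lifting) automorphisms_def bij_betw_inv_into_left mem_Collect_eq)
  then show ?thesis using inverse_automorphism[OF g(1)] by blast
qed

text \<open>Conjugating by translations brings both points into copy 0, where lifts of cyclic maps
  are available.\<close>

lemma cover_transitive:
  assumes ct: "cyclically_transitive L" and x: "x \<in> cover" and y: "y \<in> cover"
  shows "\<exists>g\<in>automorphisms. g x = y"
proof -
  obtain a k where a: "a \<in> Field L" "x = f a + of_int k" using x by (rule coverE)
  obtain b l where b: "b \<in> Field L" "y = f b + of_int l" using y by (rule coverE)
  obtain g where g: "g \<in> automorphisms" "g (f a) = f b"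
    using automorphism_of_points[OF ct a(1) b(1)] by blast
  let ?h = "(\<lambda>z. z + of_int l) \<circ> (g \<circ> (\<lambda>z. z + of_int (- k)))"
  have "?h \<in> automorphisms" by (intro compose_automorphisms translation_automorphism g(1))
  moreover have "?h x = y" using g(2) a b by simp
  ultimately show ?thesis by blast
qed

lemma countable_cover: "countable cover"
proof -
  have "cover = (\<lambda>(a, k). f a + of_int k) ` (Field L \<times> (UNIV :: int set))"
    by (auto simp: cover_def)
  then show ?thesis using countable_Field by simp
qed

text \<open>Cutting \<open>L = A + B\<close> at the same place as the cover, the fundamental domain is \<open>B\<close> followed by
  the next copy of \<open>A\<close>.\<close>

lemma cyclically_equivalent_domain:
  assumes down: "\<And>x y. x \<in> I \<Longrightarrow> y \<in> cover \<Longrightarrow> y \<le> x \<Longrightarrow> y \<in> I" and sub: "I \<subseteq> cover"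
    and low: "cover \<inter> {..<0} \<subseteq> I" and high: "I \<subseteq> {..<1}"
    and Y: "Y = {x \<in> cover. x \<notin> I \<and> x - 1 \<in> I}" and inj: "inj_on \<nu> Y"
  shows "cyclically_equivalent L (order_copy \<nu> Y)"
proof -
  define A where "A = {a \<in> Field L. f a \<in> I}"
  define B where "B = Field L - A"
  have f_cover: "f a \<in> cover" "f a + 1 \<in> cover" "f a - 1 \<in> cover" if "a \<in> Field L" for a
    using coverI[OF that, of 0] coverI[OF that, of 1] coverI[OF that, of "-1"] by simp_all
  have AY: "f a + 1 \<in> Y" if "a \<in> A" for a
    using that high unit(1)[of a] f_cover by (auto simp: A_def Y)
  have BY: "f b \<in> Y" if "b \<in> B" for b
    using that low unit(2)[of b] f_cover by (auto simp: A_def B_def Y)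
  have Y_cases: "(\<exists>a\<in>A. y = f a + 1) \<or> (\<exists>b\<in>B. y = f b)" if y: "y \<in> Y" for y
  proof -
    have y': "y - 1 \<in> I" "y \<notin> I" "y \<in> cover" using y by (auto simp: Y)
    obtain a k where a: "a \<in> Field L" "y = f a + of_int k" using y'(3) by (rule coverE)
    \<comment> \<open>Normalization places the domain inside \<open>[0, 2)\<close>, so only the
      copies 0 and 1 of \<open>L\<close> contribute.\<close>
    have "y - 1 < 1" using y'(1) high by blast
    then have "real_of_int k < 2" using a unit(1)[of a] by linarith
    moreover have "0 \<le> y" using y'(2,3) low by force
    then have "- 1 < real_of_int k" using a unit(2)[of a] by linarith
    ultimately have "k = 0 \<or> k = 1" by linarith
    then show ?thesis using a y' by (auto simp: A_def B_def)
  qed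
  have sets: "A \<subseteq> Field L" "B \<subseteq> Field L" by (auto simp: A_def B_def)
  define A' where "A' = (\<lambda>a. \<nu> (f a + 1)) ` A"
  define B' where "B' = (\<lambda>b. \<nu> (f b)) ` B"
  have field: "Field (order_copy \<nu> Y) = \<nu> ` Y" by (rule Field_order_copy)
  have sets': "A' \<subseteq> Field (order_copy \<nu> Y)" "B' \<subseteq> Field (order_copy \<nu> Y)"
    using AY BY by (auto simp: A'_def B'_def field)
  have apart: "f b < f a + 1" for a b using unit(2)[of b] unit(1)[of a] by linarith
  have "is_partition L A B"
  proof -
    have "c \<in> A" if "a \<in> A" "(c, a) \<in> L" for a c
    proof -
      have "c \<in> Field L" "a \<in> Field L" using that by (auto intro: FieldI1 FieldI2)
      then show ?thesis using down[of "f a" "f c"] f_cover f_le_iff that by (simp add: A_def)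
    qed
    then show ?thesis using sets(1) by (auto simp: is_partition_def ofilter_def under_def B_def)
  qed
  moreover have "is_partition (order_copy \<nu> Y) B' A'"
  proof -
    have "c \<in> B'" if b: "b \<in> B'" and cb: "(c, b) \<in> order_copy \<nu> Y" for b c
    proof -
      obtain b0 where b0: "b0 \<in> B" "b = \<nu> (f b0)" using b by (auto simp: B'_def)
      obtain y where y: "y \<in> Y" "c = \<nu> y" using cb by (auto simp: order_copy_def)
      have "y \<le> f b0" using order_copy_iff[OF inj y(1) BY[OF b0(1)]] cb y(2) b0(2) by simp
      then have "y \<noteq> f a + 1" for a using apart[of b0 a] by auto
      then have "\<exists>b\<in>B. y = f b" using Y_cases[OF y(1)] by blast
      then show ?thesis using y(2) by (auto simp: B'_def)
    qed
    then have "ofilter (order_copy \<nu> Y) B'" using sets'(2) by (auto simp: ofilter_def under_def)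
    moreover have "\<nu> ` Y = A' \<union> B'"
      using Y_cases AY BY by (fastforce simp: A'_def B'_def)
    moreover have "A' \<inter> B' = {}"
    proof -
      have "\<nu> (f a + 1) \<noteq> \<nu> (f b)" if "a \<in> A" "b \<in> B" for a b
        using inj_on_eq_iff[OF inj AY[OF that(1)] BY[OF that(2)]] apart[of b a] by simp
      then show ?thesis by (auto simp: A'_def B'_def)
    qed
    ultimately show ?thesis using field by (auto simp: is_partition_def)
  qed
  moreover have "iso (Restr L A) (Restr (order_copy \<nu> Y) A') (\<lambda>a. \<nu> (f a + 1))"
    unfolding iso_Restr_iff[OF Linear_orderD(1)[OF linear] sets(1)
        Linear_orderD(1)[OF Linear_order_order_copy[OF inj]] sets'(1)]
  proof (intro conjI ballI)
    show "bij_betw (\<lambda>a. \<nu> (f a + 1)) A A'"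
      unfolding bij_betw_def A'_def
    proof (intro conjI inj_onI refl)
      fix x y assume xy: "x \<in> A" "y \<in> A" "\<nu> (f x + 1) = \<nu> (f y + 1)"
      then have "f x = f y" using inj_on_eq_iff[OF inj AY AY] by simp
      then show "x = y" using inj_onD[OF inj_f] xy sets(1) by blast
    qed
    show "(x, y) \<in> L \<longleftrightarrow> (\<nu> (f x + 1), \<nu> (f y + 1)) \<in> order_copy \<nu> Y" if "x \<in> A" "y \<in> A" for x y
      using order_copy_iff[OF inj AY[OF that(1)] AY[OF that(2)]] f_le_iff that sets(1) by auto
  qed
  moreover have "iso (Restr L B) (Restr (order_copy \<nu> Y) B') (\<lambda>b. \<nu> (f b))"
    unfolding iso_Restr_iff[OF Linear_orderD(1)[OF linear] sets(2)
        Linear_orderD(1)[OF Linear_order_order_copy[OF inj]] sets'(2)]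
  proof (intro conjI ballI)
    show "bij_betw (\<lambda>b. \<nu> (f b)) B B'"
      unfolding bij_betw_def B'_def
    proof (intro conjI inj_onI refl)
      fix x y assume xy: "x \<in> B" "y \<in> B" "\<nu> (f x) = \<nu> (f y)"
      then have "f x = f y" using inj_on_eq_iff[OF inj BY BY] by simp
      then show "x = y" using inj_onD[OF inj_f] xy sets(2) by blast
    qed
    show "(x, y) \<in> L \<longleftrightarrow> (\<nu> (f x), \<nu> (f y)) \<in> order_copy \<nu> Y" if "x \<in> B" "y \<in> B" for x y
      using order_copy_iff[OF inj BY[OF that(1)] BY[OF that(2)]] f_le_iff that sets(2) by auto
  qed
  ultimately show ?thesis unfolding cyclically_equivalent_def by blast
qed

lemma classification:
  assumes ct: "cyclically_transitive L" and ne: "Field L \<noteq> {}"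
  shows "\<exists>L' :: nat rel. Linear_order L' \<and> cyclically_equivalent L L' \<and>
    (\<exists>\<alpha> :: nat rel. Well_order \<alpha> \<and>
       ((\<exists>n :: nat. same_order_type L' (colex_prod (zeta_power \<alpha>) (natLeq_on n))) \<or>
        same_order_type L' (colex_prod (zeta_power \<alpha>) eta_order)))"
proof -
  interpret periodic_chain cover
    by unfold_locales (rule countable_cover, rule cover_transitive[OF ct])
  obtain a where "a \<in> Field L" using ne by blast
  then have a: "f a \<in> cover" using coverI[of a 0] by simp
  obtain N I and w :: "nat rel" where I: "local.cut N I" "normalized I" and w: "Well_order w"
    and types: "(\<exists>n h. bij_betw h (domain_of I) (Field (colex_prod (zeta_power w) (natLeq_on n))) \<and>
        (\<forall>x\<in>domain_of I. \<forall>y\<in>domain_of I. x < y \<longrightarrow> (h x, h y) \<in> colex_prod (zeta_power w) (natLeq_on n))) \<or>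
     (\<exists>h. bij_betw h (domain_of I) (Field (colex_prod (zeta_power w) eta_order)) \<and>
        (\<forall>x\<in>domain_of I. \<forall>y\<in>domain_of I. x < y \<longrightarrow> (h x, h y) \<in> colex_prod (zeta_power w) eta_order))"
    using a by (rule domain_classification)
  define \<nu> where "\<nu> = to_nat_on (domain_of I)"
  have "domain_of I \<subseteq> cover" by (auto simp: domain_of_def)
  then have inj: "inj_on \<nu> (domain_of I)"
    unfolding \<nu>_def using countable_subset[OF _ countable_cover] by (intro inj_on_to_nat_on)
  let ?L' = "order_copy \<nu> (domain_of I)"
  have "cyclically_equivalent L ?L'"
  proof (rule cyclically_equivalent_domain[OF _ _ _ _ _ inj])
    show "I \<subseteq> cover" and "\<And>x y. x \<in> I \<Longrightarrow> y \<in> cover \<Longrightarrow> y \<le> x \<Longrightarrow> y \<in> I"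
      using I(1) unfolding cut_def by blast+
    show "cover \<inter> {..<0} \<subseteq> I" "I \<subseteq> {..<1}" using I(2) unfolding normalized_def by blast+
  qed (rule domain_of_def)
  moreover have "(\<exists>n :: nat. same_order_type ?L' (colex_prod (zeta_power w) (natLeq_on n))) \<or>
      same_order_type ?L' (colex_prod (zeta_power w) eta_order)"
    using types
  proof (elim disjE exE conjE)
    fix n h
    assume h: "bij_betw h (domain_of I) (Field (colex_prod (zeta_power w) (natLeq_on n)))"
      "\<forall>x\<in>domain_of I. \<forall>y\<in>domain_of I. x < y \<longrightarrow> (h x, h y) \<in> colex_prod (zeta_power w) (natLeq_on n)"
    have S: "refl_on (Field (natLeq_on n)) (natLeq_on n)" "antisym (natLeq_on n)"
      by (auto simp: Field_natLeq_on intro!: refl_onI antisymI)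
    have "same_order_type ?L' (colex_prod (zeta_power w) (natLeq_on n))"
      using same_order_type_order_copy[OF inj h(1)] h(2) zeta_colex_order[OF w S] by blast
    then show ?thesis by blast
  next
    fix h
    assume h: "bij_betw h (domain_of I) (Field (colex_prod (zeta_power w) eta_order))"
      "\<forall>x\<in>domain_of I. \<forall>y\<in>domain_of I. x < y \<longrightarrow> (h x, h y) \<in> colex_prod (zeta_power w) eta_order"
    have S: "refl_on (Field eta_order) eta_order" "antisym eta_order"
      by (auto simp: eta_order_def intro!: refl_onI antisymI)
    have "same_order_type ?L' (colex_prod (zeta_power w) eta_order)"
      using same_order_type_order_copy[OF inj h(1)] h(2) zeta_colex_order[OF w S] by blast
    then show ?thesis by blast
  qed
  ultimately show ?thesis using Linear_order_order_copy[OF inj] w by blast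
qed

end

theorem corollary4p11:
  fixes L :: "'a rel"
  assumes "Linear_order L"
    and "countable (Field L)"
    and "cyclically_transitive L"
  shows "\<exists>L' :: nat rel. Linear_order L' \<and> cyclically_equivalent L L' \<and>
    (\<exists>\<alpha> :: nat rel. Well_order \<alpha> \<and>
       ((\<exists>n :: nat. same_order_type L' (colex_prod (zeta_power \<alpha>) (natLeq_on n))) \<or>
        same_order_type L' (colex_prod (zeta_power \<alpha>) eta_order)))"
proof (cases "Field L = {}")
  \<comment> \<open>An empty \<open>L\<close> gives an empty cover, which has no base point
    \<open>p\<close>; it is the case \<open>n = 0\<close> of the finite products.\<close>
  case True
  then have L: "L = {}" by (auto simp: Field_def)
  have "Well_order ({} :: nat rel)" "Linear_order ({} :: nat rel)"
    by (simp_all add: well_order_on_def linear_order_on_def partial_order_on_def preorder_on_def refl_on_def)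
  moreover have "cyclically_equivalent L ({} :: nat rel)"
    unfolding cyclically_equivalent_def L
    by (intro exI[of _ "{}"] exI) (auto simp: is_partition_def ofilter_def iso_iff2 bij_betw_def)
  moreover have "colex_prod (zeta_power ({} :: nat rel)) (natLeq_on 0) = {}"
    by (auto simp: colex_prod_def Field_def)
  then have "same_order_type ({} :: nat rel) (colex_prod (zeta_power ({} :: nat rel)) (natLeq_on 0))"
    by (simp add: same_order_type_def iso_iff2 bij_betw_def)
  ultimately show ?thesis by blast
next
  case False
  obtain f :: "'a \<Rightarrow> real" where f: "\<And>a. 0 \<le> f a \<and> f a < 1" "\<And>a b. (a, b) \<in> L \<Longrightarrow> a \<noteq> b \<Longrightarrow> f a < f b"
    using embed_in_unit_interval[OF assms(1,2)] by metis
  interpret unit_embedding L f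
    by unfold_locales (use assms f in auto)
  show ?thesis by (rule classification[OF assms(3) False])
qed

end
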